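(* Let $s,t\in\mathbb{R}$ with $s,t>1/2$. If $G=(V,E)$ is a finite simple graph with $V\ne\emptyset$ satisfying $\|V\|-(s+t+1)|V|\ge 0$, then there exist disjoint non-empty sets $A,B\subseteq V$ such that (1) $\|A\|-s|A|\ge 0$; (2) $\|B\|-t|B|\ge 0$; (3) $\|A\|-s|A|+\|B\|-t|B|\ge T(A\cup B)-1$, where $T(X)=\max\{0,\ \|X\|-(s+t+1)|X|\}$ for $X\subseteq V$.
   Context: For a graph $G=(V,E)$ and a subset $X\subseteq V$, $|X|$ denotes the number of vertices in $X$ and $\|X\|$ denotes the number of edges of the induced subgraph $G[X]$; in particular $\|V\|=|E|$. Graphs are finite, simple (no loops, no multiple edges) and undirected. *)

theory Defs
  imports Complex_Main
begin

text \<open>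
  An edge is the two-element set of its ends, so loops and multiple edges are excluded.
\<close>

locale finite_simple_graph =
  fixes V :: "'a set" and E :: "'a set set"
  assumes finite_vertices: "finite V"
    and edge_subset: "e \<in> E \<Longrightarrow> e \<subseteq> V"
    and edge_card: "e \<in> E \<Longrightarrow> card e = 2"

definition induced_edges :: "'a set set \<Rightarrow> 'a set \<Rightarrow> 'a set set" where
  "induced_edges E X = {e \<in> E. e \<subseteq> X}"

definition num_edges :: "'a set set \<Rightarrow> 'a set \<Rightarrow> nat" where
  "num_edges E X = card (induced_edges E X)"

definition excess :: "'a set set \<Rightarrow> real \<Rightarrow> real \<Rightarrow> 'a set \<Rightarrow> real" where
  "excess E s t X = max 0 (real (num_edges E X) - (s + t + 1) * real (card X))"

end

theory Submission
  imports Defs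
begin

text \<open>
  Write h(X) = ||X|| - (s + t + 1)|X|.  Replacing V by a smallest non-empty set with h \<ge> 0 makes
  T vanish on all proper subsets, so that (3) says something only about partitions of V.  In this
  core, with \<rho> = |E|/|V| and d = \<rho> - (s + t + 1), every degree exceeds \<rho>, every clique has at most
  N = 2\<rho> + 1 vertices, and d \<le> 1/2.

  The proof rounds a fractional partition.  A vertex v belongs to A to the extent x(v) and to B to the
  extent 1 - x(v); with W(x) the sum of x(u)x(v) over the edges uv, p = (s + 1)/(s + t + 2) and
  q = 1 - p, put F(x) = W(x) - p\<rho>\<Sum>x and G(x) = W(1 - x) - q\<rho>\<Sum>(1 - x).  The constant x = p has
  F = G = 0.  Since p\<rho> = s + q + pd and q\<rho> = t + p + qd, an integral point with F, G \<ge> 0 satisfies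
  (1) and (2) with a reserve of q + pd for each vertex of A and of p + qd for each vertex of B.  The
  reserve pays for the last steps of the rounding.

  The difference G - F is affine.  Moving two coordinates at once, so that this difference stays
  fixed, changes F and G by the same quadratic polynomial of the step length, and its quadratic term
  vanishes for non-adjacent vertices.  One of the two directions therefore loses nothing, and
  repeating such moves makes the set K of fractional vertices a clique (\<open>round_pairs\<close>).  For adjacent
  vertices the polynomial becomes convex after half of the sum of all x(v)^2 is added; so all but one
  vertex u of K can be rounded at a total cost of at most \<Sum>x(1 - x)/2, and this is at most pqN/2 if K
  has weight at most pN on the side of A and at most qN on the side of B (\<open>split_small_clique\<close>).  If K has weight more
  than pN on the side of A, then that part of K is by itself dense enough to serve as A, and only G has
  to be watched (\<open>split_large_clique\<close>); the other case is symmetric.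

  What remains is one vertex u with x(u) = \<theta> between 0 and 1.  An elementary estimate shows that
  |A| + \<theta> is either at most q or at least pN (\<open>size_dichotomy\<close>), and the first alternative is excluded.
  Putting u into B is harmless for A if \<theta> \<le> q, putting it into A is harmless for B if \<theta> \<ge> q, and a
  convex combination of the two choices satisfies (3), hence one of them does.  A choice satisfying (1), (2) and (3) together
  exists by \<open>assign_last_vertex\<close>; d \<le> 1/2 is what makes the numbers fit.
\<close>

section \<open>Edge counts of fractional vertex sets\<close>

text \<open>
  The multilinear extension of the number of edges: on the indicator function of a set it counts the
  induced edges, and \<open>link_weight\<close> is its partial derivative.
\<close>

definition edge_weight :: "'a set set \<Rightarrow> ('a \<Rightarrow> real) \<Rightarrow> real" where
  "edge_weight E x = (\<Sum>e\<in>E. \<Prod>v\<in>e. x v)"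

definition link_weight :: "'a set \<Rightarrow> 'a set set \<Rightarrow> ('a \<Rightarrow> real) \<Rightarrow> 'a \<Rightarrow> real" where
  "link_weight V E x u = (\<Sum>v | v \<in> V \<and> v \<noteq> u \<and> {u, v} \<in> E. x v)"

lemma (in finite_simple_graph) finite_edges: "finite E"
  by (rule finite_subset[of _ "Pow V"]) (use edge_subset finite_vertices in auto)

lemma (in finite_simple_graph) edge_endpoints:
  assumes "e \<in> E"
  obtains u v where "e = {u, v}" "u \<noteq> v" "u \<in> V" "v \<in> V"
  using edge_card[OF assms] edge_subset[OF assms] by (auto simp: card_2_iff)

lemma (in finite_simple_graph) link_weight_edges:
  assumes "u \<in> V"
  shows "link_weight V E x u = (\<Sum>e | e \<in> E \<and> u \<in> e. \<Prod>v\<in>e - {u}. x v)"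
  unfolding link_weight_def
proof (rule sym, rule sum.reindex_cong)
  show "inj_on (\<lambda>v. {u, v}) {v \<in> V. v \<noteq> u \<and> {u, v} \<in> E}"
    by (auto simp: inj_on_def doubleton_eq_iff)
  show "{e \<in> E. u \<in> e} = (\<lambda>v. {u, v}) ` {v \<in> V. v \<noteq> u \<and> {u, v} \<in> E}"
  proof (intro equalityI subsetI)
    fix e assume "e \<in> {e \<in> E. u \<in> e}"
    then have e: "e \<in> E" "u \<in> e" by auto
    obtain a b where ab: "e = {a, b}" "a \<noteq> b" "a \<in> V" "b \<in> V"
      using edge_endpoints[OF e(1)] by metis
    define c where "c = (if u = a then b else a)"
    have "e = {u, c}" "c \<in> V" "c \<noteq> u"
      using ab e(2) by (auto simp: c_def)
    then show "e \<in> (\<lambda>v. {u, v}) ` {v \<in> V. v \<noteq> u \<and> {u, v} \<in> E}"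
      using e(1) by auto
  qed auto
  show "(\<Prod>v\<in>{u, v} - {u}. x v) = x v" if "v \<in> {v \<in> V. v \<noteq> u \<and> {u, v} \<in> E}" for v
  proof -
    have "{u, v} - {u} = {v}" using that by auto
    then show ?thesis by simp
  qed
qed

lemma (in finite_simple_graph) edge_weight_update:
  assumes "u \<in> V"
  shows "edge_weight E (x(u := r)) = edge_weight E x + (r - x u) * link_weight V E x u"
proof -
  have fin: "finite e" if "e \<in> E" for e
    using that edge_subset finite_vertices finite_subset by metis
  have "edge_weight E (x(u := r)) - edge_weight E x
      = (\<Sum>e\<in>E. (\<Prod>v\<in>e. (x(u := r)) v) - (\<Prod>v\<in>e. x v))"
    by (simp add: edge_weight_def sum_subtractf)
  also have "\<dots> = (\<Sum>e\<in>E. if u \<in> e then (r - x u) * (\<Prod>v\<in>e - {u}. x v) else 0)"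
  proof (rule sum.cong[OF refl])
    fix e assume e: "e \<in> E"
    show "(\<Prod>v\<in>e. (x(u := r)) v) - (\<Prod>v\<in>e. x v)
        = (if u \<in> e then (r - x u) * (\<Prod>v\<in>e - {u}. x v) else 0)"
    proof (cases "u \<in> e")
      case True
      have "(\<Prod>v\<in>e. (x(u := r)) v) = r * (\<Prod>v\<in>e - {u}. (x(u := r)) v)"
        using prod.remove[OF fin[OF e] True, of "x(u := r)"] by simp
      also have "(\<Prod>v\<in>e - {u}. (x(u := r)) v) = (\<Prod>v\<in>e - {u}. x v)"
        by (rule prod.cong) auto
      finally show ?thesis
        using prod.remove[OF fin[OF e] True, of x] True by (simp add: algebra_simps)
    next
      case False
      have "(\<Prod>v\<in>e. (x(u := r)) v) = (\<Prod>v\<in>e. x v)"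
        using False by (intro prod.cong) auto
      then show ?thesis using False by simp
    qed
  qed
  also have "\<dots> = (\<Sum>e | e \<in> E \<and> u \<in> e. (r - x u) * (\<Prod>v\<in>e - {u}. x v))"
    using finite_edges by (simp add: sum.inter_filter)
  also have "\<dots> = (r - x u) * link_weight V E x u"
    by (simp add: link_weight_edges[OF assms] sum_distrib_left)
  finally show ?thesis by simp
qed

lemma (in finite_simple_graph) link_weight_update:
  assumes "u \<in> V" "v \<noteq> u"
  shows "link_weight V E (x(u := r)) v = link_weight V E x v + (if {u, v} \<in> E then r - x u else 0)"
proof -
  let ?S = "{z. z \<in> V \<and> z \<noteq> v \<and> {v, z} \<in> E}"
  have fin: "finite ?S" using finite_vertices by auto
  have "link_weight V E (x(u := r)) v - link_weight V E x v
      = (\<Sum>z\<in>?S. (x(u := r)) z - x z)"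
    by (simp add: link_weight_def sum_subtractf)
  also have "\<dots> = (\<Sum>z\<in>?S. if z = u then r - x u else 0)"
    by (rule sum.cong) auto
  also have "\<dots> = (if u \<in> ?S then r - x u else 0)"
    using fin by (simp add: sum.delta)
  finally show ?thesis using assms by (auto simp: insert_commute)
qed

text \<open>
  Euler's identity for the quadratic form; on a constant function it is the handshake lemma.
\<close>

lemma (in finite_simple_graph) edge_weight_handshake:
  "2 * edge_weight E x = (\<Sum>u\<in>V. x u * link_weight V E x u)"
proof -
  have fin: "finite e" if "e \<in> E" for e
    using that edge_subset finite_vertices finite_subset by metis
  have "(\<Sum>u\<in>V. x u * link_weight V E x u)
      = (\<Sum>u\<in>V. \<Sum>e | e \<in> E \<and> u \<in> e. \<Prod>v\<in>e. x v)"
  proof (rule sum.cong[OF refl])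
    fix u assume u: "u \<in> V"
    show "x u * link_weight V E x u = (\<Sum>e | e \<in> E \<and> u \<in> e. \<Prod>v\<in>e. x v)"
      unfolding link_weight_edges[OF u] sum_distrib_left
    proof (rule sum.cong[OF refl])
      fix e assume "e \<in> {e \<in> E. u \<in> e}"
      then show "x u * (\<Prod>v\<in>e - {u}. x v) = (\<Prod>v\<in>e. x v)"
        using prod.remove[where A = e and x = u and g = x] fin by simp
    qed
  qed
  also have "\<dots> = (\<Sum>e\<in>E. \<Sum>u | u \<in> V \<and> u \<in> e. \<Prod>v\<in>e. x v)"
    using finite_vertices finite_edges by (rule sum.swap_restrict)
  also have "\<dots> = (\<Sum>e\<in>E. 2 * (\<Prod>v\<in>e. x v))"
  proof (rule sum.cong[OF refl])
    fix e assume e: "e \<in> E"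
    have "{u. u \<in> V \<and> u \<in> e} = e" using edge_subset[OF e] by auto
    then show "(\<Sum>u | u \<in> V \<and> u \<in> e. \<Prod>v\<in>e. x v) = 2 * (\<Prod>v\<in>e. x v)"
      using edge_card[OF e] by simp
  qed
  finally show ?thesis by (simp add: edge_weight_def sum_distrib_left)
qed

lemma (in finite_simple_graph) link_weight_le:
  assumes "\<And>v. v \<in> V \<Longrightarrow> 0 \<le> x v" "u \<in> V"
  shows "link_weight V E x u \<le> sum x V - x u"
proof -
  have "link_weight V E x u \<le> sum x (V - {u})"
    unfolding link_weight_def using finite_vertices assms by (intro sum_mono2) auto
  then show ?thesis
    using sum.remove[OF finite_vertices assms(2), of x] by simp
qed

lemma (in finite_simple_graph) edge_weight_le:
  assumes "\<And>v. v \<in> V \<Longrightarrow> 0 \<le> x v"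
  shows "2 * edge_weight E x \<le> (sum x V)\<^sup>2 - (\<Sum>v\<in>V. (x v)\<^sup>2)"
proof -
  have "2 * edge_weight E x \<le> (\<Sum>u\<in>V. x u * (sum x V - x u))"
    unfolding edge_weight_handshake using assms link_weight_le
    by (intro sum_mono mult_left_mono) auto
  also have "\<dots> = (sum x V)\<^sup>2 - (\<Sum>v\<in>V. (x v)\<^sup>2)"
    by (simp add: algebra_simps sum_subtractf power2_eq_square sum_distrib_left sum_distrib_right)
  finally show ?thesis .
qed

lemma (in finite_simple_graph) link_weight_clique:
  assumes "K \<subseteq> V" "\<And>u v. u \<in> K \<Longrightarrow> v \<in> K \<Longrightarrow> u \<noteq> v \<Longrightarrow> {u, v} \<in> E"
    and "\<And>v. v \<in> V - K \<Longrightarrow> x v = 0" "u \<in> K"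
  shows "link_weight V E x u = sum x V - x u"
proof -
  have "link_weight V E x u = sum x (V - {u})"
    unfolding link_weight_def using finite_vertices assms by (intro sum.mono_neutral_left) auto
  then show ?thesis
    using sum.remove[OF finite_vertices, where x = u and g = x] assms by auto
qed

lemma (in finite_simple_graph) edge_weight_clique:
  assumes "K \<subseteq> V" "\<And>u v. u \<in> K \<Longrightarrow> v \<in> K \<Longrightarrow> u \<noteq> v \<Longrightarrow> {u, v} \<in> E"
    and "\<And>v. v \<in> V - K \<Longrightarrow> x v = 0"
  shows "2 * edge_weight E x = (sum x V)\<^sup>2 - (\<Sum>v\<in>V. (x v)\<^sup>2)"
proof -
  have "2 * edge_weight E x = (\<Sum>u\<in>V. x u * (sum x V - x u))"
    unfolding edge_weight_handshake
  proof (rule sum.cong[OF refl])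
    fix u assume "u \<in> V"
    then show "x u * link_weight V E x u = x u * (sum x V - x u)"
      using link_weight_clique[OF assms, where u = u] assms(3)[of u] by (cases "u \<in> K") auto
  qed
  also have "\<dots> = (sum x V)\<^sup>2 - (\<Sum>v\<in>V. (x v)\<^sup>2)"
    by (simp add: algebra_simps sum_subtractf power2_eq_square sum_distrib_left sum_distrib_right)
  finally show ?thesis .
qed

lemma (in finite_simple_graph) edge_weight_cong:
  assumes "\<And>v. v \<in> V \<Longrightarrow> x v = y v"
  shows "edge_weight E x = edge_weight E y"
  unfolding edge_weight_def using assms edge_subset by (intro sum.cong prod.cong) auto

lemma (in finite_simple_graph) edge_weight_of_bool:
  "edge_weight E (\<lambda>v. of_bool (v \<in> A)) = real (num_edges E A)"
proof -
  have fin: "finite e" if "e \<in> E" for e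
    using that edge_subset finite_vertices finite_subset by metis
  have "edge_weight E (\<lambda>v. of_bool (v \<in> A)) = (\<Sum>e\<in>E. of_bool (e \<subseteq> A))"
    unfolding edge_weight_def
  proof (rule sum.cong[OF refl])
    fix e assume e: "e \<in> E"
    show "(\<Prod>v\<in>e. of_bool (v \<in> A)) = (of_bool (e \<subseteq> A) :: real)"
    proof (cases "e \<subseteq> A")
      case True
      then show ?thesis by (auto intro!: prod.neutral)
    next
      case False
      then show ?thesis using fin[OF e] by (auto simp: prod_zero_iff)
    qed
  qed
  also have "\<dots> = real (num_edges E A)"
    using finite_edges by (simp add: num_edges_def induced_edges_def sum.inter_filter of_bool_def flip: sum.inter_filter)
  finally show ?thesis .
qed

text \<open>
  On every edge ab one has (1 - x(a))(1 - x(b)) = 1 - x(a) - x(b) + x(a)x(b).  The quadratic parts of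
  the weights of x and 1 - x agree, so their difference is affine.
\<close>

lemma (in finite_simple_graph) edge_weight_complement:
  "edge_weight E (\<lambda>v. 1 - x v)
    = edge_weight E x + real (card E) - (\<Sum>v\<in>V. link_weight V E (\<lambda>_. 1) v * x v)"
proof -
  have "(\<Sum>v\<in>V. link_weight V E (\<lambda>_. 1) v * x v) = (\<Sum>v\<in>V. \<Sum>e | e \<in> E \<and> v \<in> e. x v)"
    by (rule sum.cong) (simp_all add: link_weight_edges)
  also have "\<dots> = (\<Sum>e\<in>E. \<Sum>v | v \<in> V \<and> v \<in> e. x v)"
    using finite_vertices finite_edges by (rule sum.swap_restrict)
  also have "\<dots> = (\<Sum>e\<in>E. (\<Prod>v\<in>e. x v) + 1 - (\<Prod>v\<in>e. 1 - x v))"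
  proof (rule sum.cong[OF refl])
    fix e assume e: "e \<in> E"
    obtain a b where ab: "e = {a, b}" "a \<noteq> b" "a \<in> V" "b \<in> V"
      using edge_endpoints[OF e] by metis
    have "{v. v \<in> V \<and> v \<in> e} = {a, b}" using ab by auto
    then show "(\<Sum>v | v \<in> V \<and> v \<in> e. x v) = (\<Prod>v\<in>e. x v) + 1 - (\<Prod>v\<in>e. 1 - x v)"
      using ab by (simp add: algebra_simps)
  qed
  also have "\<dots> = edge_weight E x + real (card E) - edge_weight E (\<lambda>v. 1 - x v)"
    by (simp add: edge_weight_def sum_subtractf sum.distrib)
  finally show ?thesis by simp
qed

section \<open>Rounding fractional vertex sets\<close>

definition fractional :: "'a set \<Rightarrow> ('a \<Rightarrow> real) \<Rightarrow> 'a set" where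
  "fractional V x = {v \<in> V. 0 < x v \<and> x v < 1}"

text \<open>
  The last term, with k = 1/2, is the credit that makes moves along an edge convex: in the
  direction (a, b) the product x(u)x(v) has the quadratic term ab, which is at least -(a^2 + b^2)/2, and
  the credit contributes (a^2 + b^2)/2.  At integral points it vanishes.
\<close>

definition surplus :: "'a set \<Rightarrow> 'a set set \<Rightarrow> real \<Rightarrow> real \<Rightarrow> ('a \<Rightarrow> real) \<Rightarrow> real" where
  "surplus V E k c x = edge_weight E x - c * sum x V - k * (\<Sum>v\<in>V. x v * (1 - x v))"

lemma not_fractional:
  "v \<in> V \<Longrightarrow> 0 \<le> x v \<and> x v \<le> 1 \<Longrightarrow> v \<notin> fractional V x \<Longrightarrow> x v = 0 \<or> x v = 1"
  by (auto simp: fractional_def)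

lemma sum_fun_upd:
  fixes h :: "'a \<Rightarrow> 'b \<Rightarrow> real"
  assumes "finite V" "u \<in> V"
  shows "(\<Sum>v\<in>V. h v ((x(u := r)) v)) = (\<Sum>v\<in>V. h v (x v)) + h u r - h u (x u)"
proof -
  have "(\<Sum>v\<in>V - {u}. h v ((x(u := r)) v)) = (\<Sum>v\<in>V - {u}. h v (x v))"
    by (rule sum.cong) auto
  then show ?thesis
    using sum.remove[OF assms, of "\<lambda>v. h v ((x(u := r)) v)"] sum.remove[OF assms, of "\<lambda>v. h v (x v)"]
    by simp
qed

lemma (in finite_simple_graph) surplus_update:
  assumes "u \<in> V"
  shows "surplus V E k c (x(u := x u + a))
    = surplus V E k c x + a * (link_weight V E x u - c - k * (1 - 2 * x u)) + k * a\<^sup>2"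
  unfolding surplus_def edge_weight_update[OF assms]
    sum_fun_upd[OF finite_vertices assms, of "\<lambda>_ r. r"]
    sum_fun_upd[OF finite_vertices assms, of "\<lambda>_ r. r * (1 - r)"]
  by (simp add: algebra_simps power2_eq_square)

lemma (in finite_simple_graph) surplus_update2:
  assumes "u \<in> V" "v \<in> V" "u \<noteq> v"
  shows "surplus V E k c (x(u := x u + a, v := x v + b))
    = surplus V E k c x + a * (link_weight V E x u - c - k * (1 - 2 * x u))
       + b * (link_weight V E x v - c - k * (1 - 2 * x v))
       + (k * (a\<^sup>2 + b\<^sup>2) + (if {u, v} \<in> E then a * b else 0))"
proof -
  have "surplus V E k c ((x(u := x u + a))(v := (x(u := x u + a)) v + b))
      = surplus V E k c (x(u := x u + a))
        + b * (link_weight V E (x(u := x u + a)) v - c - k * (1 - 2 * (x(u := x u + a)) v)) + k * b\<^sup>2"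
    by (rule surplus_update[OF assms(2)])
  moreover have "(x(u := x u + a)) v = x v" using assms by simp
  moreover have "link_weight V E (x(u := x u + a)) v = link_weight V E x v + (if {u, v} \<in> E then a else 0)"
    using link_weight_update[OF assms(1) assms(3)[symmetric], of x "x u + a"] by simp
  ultimately have eq: "surplus V E k c (x(u := x u + a, v := x v + b))
      = surplus V E k c x + a * (link_weight V E x u - c - k * (1 - 2 * x u)) + k * a\<^sup>2
        + b * (link_weight V E x v + (if {u, v} \<in> E then a else 0) - c - k * (1 - 2 * x v)) + k * b\<^sup>2"
    by (simp add: surplus_update[OF assms(1)])
  show ?thesis unfolding eq by (simp add: algebra_simps)
qed

lemma exit_time:
  fixes a d :: real
  assumes "0 < a" "a < 1" "d \<noteq> 0"
  obtains r where "0 < r" "\<And>t. 0 \<le> t \<Longrightarrow> t \<le> r \<Longrightarrow> 0 \<le> a + t * d \<and> a + t * d \<le> 1"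
    "a + r * d \<in> {0, 1}"
proof (cases "d > 0")
  case True
  show ?thesis
  proof (rule that[of "(1 - a) / d"])
    fix t assume t: "0 \<le> t" "t \<le> (1 - a) / d"
    then have "t * d \<le> 1 - a" using True by (simp add: field_simps)
    then show "0 \<le> a + t * d \<and> a + t * d \<le> 1" using t True assms by auto
  qed (use True assms in auto)
next
  case False
  then have d: "d < 0" using assms by simp
  show ?thesis
  proof (rule that[of "a / (- d)"])
    show "0 < a / (- d)" using d assms by (simp add: divide_pos_neg)
  next
    fix t assume t: "0 \<le> t" "t \<le> a / (- d)"
    then have "t * (- d) \<le> a" using d by (simp add: field_simps)
    moreover have "t * d \<le> 0" using t d by (simp add: mult_nonneg_nonpos)
    ultimately show "0 \<le> a + t * d \<and> a + t * d \<le> 1" using assms by auto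
  qed (use d in auto)
qed

lemma leave_unit_square:
  fixes a b d e :: real
  assumes "0 < a" "a < 1" "0 < b" "b < 1" "d \<noteq> 0 \<or> e \<noteq> 0"
  obtains t where "0 \<le> t" "0 \<le> a + t * d" "a + t * d \<le> 1" "0 \<le> b + t * e" "b + t * e \<le> 1"
    "a + t * d \<in> {0, 1} \<or> b + t * e \<in> {0, 1}"
proof -
  consider "d = 0" "e \<noteq> 0" | "d \<noteq> 0" "e = 0" | "d \<noteq> 0" "e \<noteq> 0" using assms by auto
  then show ?thesis
  proof cases
    case 1
    obtain r where "0 < r" "\<And>t. 0 \<le> t \<Longrightarrow> t \<le> r \<Longrightarrow> 0 \<le> b + t * e \<and> b + t * e \<le> 1"
      "b + r * e \<in> {0, 1}" using exit_time[of b e] assms 1 by blast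
    then show ?thesis using that[of r] 1 assms by auto
  next
    case 2
    obtain r where "0 < r" "\<And>t. 0 \<le> t \<Longrightarrow> t \<le> r \<Longrightarrow> 0 \<le> a + t * d \<and> a + t * d \<le> 1"
      "a + r * d \<in> {0, 1}" using exit_time[of a d] assms 2 by blast
    then show ?thesis using that[of r] 2 assms by auto
  next
    case 3
    obtain r where r: "0 < r" "\<And>t. 0 \<le> t \<Longrightarrow> t \<le> r \<Longrightarrow> 0 \<le> a + t * d \<and> a + t * d \<le> 1"
      "a + r * d \<in> {0, 1}" using exit_time[of a d] assms 3 by blast
    obtain r' where r': "0 < r'" "\<And>t. 0 \<le> t \<Longrightarrow> t \<le> r' \<Longrightarrow> 0 \<le> b + t * e \<and> b + t * e \<le> 1"
      "b + r' * e \<in> {0, 1}" using exit_time[of b e] assms 3 by blast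
    show ?thesis
    proof (cases "r \<le> r'")
      case True
      then show ?thesis using that[of r] r(1,3) r(2)[of r] r'(2)[of r] by auto
    next
      case False
      then show ?thesis using that[of r'] r'(1,3) r(2)[of r'] r'(2)[of r'] by auto
    qed
  qed
qed

text \<open>
  Along a line that preserves the weighted sum the surplus is a convex quadratic, so it does not drop
  in one of the two directions; that direction is followed to the boundary of the unit square.
\<close>

lemma (in finite_simple_graph) pair_move:
  assumes uv: "u \<in> V" "v \<in> V" "u \<noteq> v" and x: "0 < x u" "x u < 1" "0 < x v" "x v < 1"
    and k: "0 \<le> k" "{u, v} \<in> E \<Longrightarrow> 1 / 2 \<le> k"
  shows "\<exists>y. (\<forall>z. z \<noteq> u \<longrightarrow> z \<noteq> v \<longrightarrow> y z = x z)
    \<and> 0 \<le> y u \<and> y u \<le> 1 \<and> 0 \<le> y v \<and> y v \<le> 1 \<and> (y u \<in> {0, 1} \<or> y v \<in> {0, 1})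
    \<and> (\<Sum>z\<in>V. w z * y z) = (\<Sum>z\<in>V. w z * x z)
    \<and> surplus V E k c x \<le> surplus V E k c y"
proof -
  obtain a b where ab: "a \<noteq> 0 \<or> b \<noteq> 0" "w u * a + w v * b = 0"
  proof (cases "w u = 0 \<and> w v = 0")
    case True
    then show ?thesis using that[of 1 0] by simp
  next
    case False
    then show ?thesis using that[of "w v" "- w u"] by auto
  qed
  define slope where "slope a b = a * (link_weight V E x u - c - k * (1 - 2 * x u))
       + b * (link_weight V E x v - c - k * (1 - 2 * x v))" for a b
  obtain a b where ab: "a \<noteq> 0 \<or> b \<noteq> 0" "w u * a + w v * b = 0" "0 \<le> slope a b"
  proof (cases "0 \<le> slope a b")
    case True
    then show ?thesis using that ab by blast
  next
    case False
    then have "0 \<le> slope (- a) (- b)" by (simp add: slope_def)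
    moreover have "w u * (- a) + w v * (- b) = 0" using ab by simp
    ultimately show ?thesis using that[of "- a" "- b"] ab by auto
  qed
  obtain t where t: "0 \<le> t" "0 \<le> x u + t * a" "x u + t * a \<le> 1" "0 \<le> x v + t * b" "x v + t * b \<le> 1"
    "x u + t * a \<in> {0, 1} \<or> x v + t * b \<in> {0, 1}"
    using leave_unit_square[OF x ab(1)] by blast
  define y where "y = x(u := x u + t * a, v := x v + t * b)"
  \<comment> \<open>the second derivative along the line\<close>
  have "0 \<le> k * (a\<^sup>2 + b\<^sup>2) + (if {u, v} \<in> E then a * b else 0)"
  proof (cases "{u, v} \<in> E")
    case True
    have "1 / 2 * (a\<^sup>2 + b\<^sup>2) \<le> k * (a\<^sup>2 + b\<^sup>2)"
      using k(2)[OF True] by (intro mult_right_mono) auto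
    moreover have "0 \<le> (a + b)\<^sup>2" by simp
    ultimately show ?thesis using True by (simp add: power2_sum)
  next
    case False
    then show ?thesis using k by simp
  qed
  then have "0 \<le> t * slope a b + t\<^sup>2 * (k * (a\<^sup>2 + b\<^sup>2) + (if {u, v} \<in> E then a * b else 0))"
    using t(1) ab(3) by simp
  also have "\<dots> = surplus V E k c y - surplus V E k c x"
    unfolding y_def surplus_update2[OF uv] slope_def
    by (simp add: algebra_simps power2_eq_square)
  finally have "surplus V E k c x \<le> surplus V E k c y" by simp
  moreover have "(\<Sum>z\<in>V. w z * y z) = (\<Sum>z\<in>V. w z * x z) + t * (w u * a + w v * b)"
    unfolding y_def sum_fun_upd[OF finite_vertices uv(2), of "\<lambda>z r. w z * r"]
      sum_fun_upd[OF finite_vertices uv(1), of "\<lambda>z r. w z * r"]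
    using uv by (simp add: algebra_simps)
  moreover have "y u = x u + t * a" "y v = x v + t * b" using uv by (simp_all add: y_def)
  moreover have "y z = x z" if "z \<noteq> u" "z \<noteq> v" for z using that by (simp add: y_def)
  ultimately show ?thesis
    using t ab(2) by (intro exI[of _ y]) simp
qed

text \<open>
  Moves are repeated until no admissible pair is left.  For k = 0 the fractional vertices then form a
  clique, for k = 1/2 there is at most one of them.
\<close>

lemma (in finite_simple_graph) round_pairs:
  assumes "\<And>v. v \<in> V \<Longrightarrow> 0 \<le> x v \<and> x v \<le> 1" "0 \<le> k"
  shows "\<exists>y. (\<forall>v\<in>V. 0 \<le> y v \<and> y v \<le> 1) \<and> (\<forall>v. v \<notin> fractional V x \<longrightarrow> y v = x v)
    \<and> (\<Sum>v\<in>V. w v * y v) = (\<Sum>v\<in>V. w v * x v)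
    \<and> surplus V E k c x \<le> surplus V E k c y
    \<and> (\<forall>u\<in>fractional V y. \<forall>v\<in>fractional V y. u \<noteq> v \<longrightarrow> {u, v} \<in> E \<and> k < 1 / 2)"
  using assms(1)
proof (induction "card (fractional V x)" arbitrary: x rule: less_induct)
  case less
  show ?case
  proof (cases "\<forall>u \<in> fractional V x. \<forall>v \<in> fractional V x. u \<noteq> v \<longrightarrow> {u, v} \<in> E \<and> k < 1 / 2")
    case True
    then show ?thesis using less.prems by (intro exI[of _ x]) simp
  next
    case False
    then obtain u v where uv: "u \<in> fractional V x" "v \<in> fractional V x" "u \<noteq> v"
      and "\<not> ({u, v} \<in> E \<and> k < 1 / 2)" by blast
    then have k: "{u, v} \<in> E \<Longrightarrow> 1 / 2 \<le> k" by simp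
    have uv': "u \<in> V" "v \<in> V" "0 < x u" "x u < 1" "0 < x v" "x v < 1"
      using uv by (auto simp: fractional_def)
    obtain y where y: "\<forall>z. z \<noteq> u \<longrightarrow> z \<noteq> v \<longrightarrow> y z = x z"
      "0 \<le> y u" "y u \<le> 1" "0 \<le> y v" "y v \<le> 1" "y u \<in> {0, 1} \<or> y v \<in> {0, 1}"
      "(\<Sum>z\<in>V. w z * y z) = (\<Sum>z\<in>V. w z * x z)"
      "surplus V E k c x \<le> surplus V E k c y"
      using pair_move[OF uv'(1,2) uv(3) uv'(3-6) assms(2) k, where w = w and c = c] by blast
    have sub: "fractional V y \<subseteq> fractional V x"
    proof
      fix z assume z: "z \<in> fractional V y"
      show "z \<in> fractional V x"
      proof (cases "z = u \<or> z = v")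
        case False
        then have "y z = x z" using y(1) by simp
        then show ?thesis using z by (simp add: fractional_def)
      qed (use uv in auto)
    qed
    have "u \<notin> fractional V y \<or> v \<notin> fractional V y"
      using y(6) by (auto simp: fractional_def)
    then have "fractional V y \<subset> fractional V x" using sub uv by auto
    moreover have "finite (fractional V x)" using finite_vertices by (simp add: fractional_def)
    ultimately have lt: "card (fractional V y) < card (fractional V x)" by (rule psubset_card_mono[rotated])
    have y01: "0 \<le> y z \<and> y z \<le> 1" if "z \<in> V" for z
      using y(1)[rule_format, of z] y(2-5) less.prems[OF that] by (cases "z = u \<or> z = v") auto
    obtain y' where y': "\<forall>v\<in>V. 0 \<le> y' v \<and> y' v \<le> 1"
      "\<forall>v. v \<notin> fractional V y \<longrightarrow> y' v = y v"
      "(\<Sum>v\<in>V. w v * y' v) = (\<Sum>v\<in>V. w v * y v)"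
      "surplus V E k c y \<le> surplus V E k c y'"
      "\<forall>u\<in>fractional V y'. \<forall>v\<in>fractional V y'. u \<noteq> v \<longrightarrow> {u, v} \<in> E \<and> k < 1 / 2"
      using less.hyps[OF lt y01] by blast
    have "y' z = x z" if "z \<notin> fractional V x" for z
    proof -
      have "z \<noteq> u" "z \<noteq> v" "z \<notin> fractional V y" using that sub uv(1,2) by auto
      then show ?thesis using y'(2) y(1) by simp
    qed
    moreover have "surplus V E k c x \<le> surplus V E k c y'" using y(8) y'(4) by simp
    moreover have "(\<Sum>v\<in>V. w v * y' v) = (\<Sum>v\<in>V. w v * x v)" using y(7) y'(3) by simp
    ultimately show ?thesis using y'(1,5) by (intro exI[of _ y']) simp
  qed
qed

text \<open>
  A point of small total weight has too few edges: its edge weight is at most half of the squared sum.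
\<close>

lemma (in finite_simple_graph) sum_ge_if_surplus_nonneg:
  assumes "\<And>v. v \<in> V \<Longrightarrow> 0 \<le> y v" "0 \<le> surplus V E 0 c y" "0 < sum y V"
  shows "2 * c \<le> sum y V"
proof -
  have "2 * c * sum y V \<le> 2 * edge_weight E y" using assms(2) by (simp add: surplus_def)
  also have "\<dots> \<le> (sum y V)\<^sup>2"
    using edge_weight_le[of y] assms(1) sum_nonneg[of V "\<lambda>v. (y v)\<^sup>2"] by force
  finally show ?thesis using assms(3) by (simp add: power2_eq_square)
qed

text \<open>
  The surplus with k = 0 is affine in each coordinate, hence a fractional coordinate can always be
  moved: up if the slope is positive, until it is 1 or the sum over K hits T, and otherwise down to 0.
  The point never becomes 0, because a non-zero point with non-negative surplus has total weight at
  least 2c > 1.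
\<close>

lemma (in finite_simple_graph) adjust_to_target:
  assumes "\<And>v. v \<in> V \<Longrightarrow> 0 \<le> y v \<and> y v \<le> 1" "fractional V y \<subseteq> K" "K \<subseteq> V"
    and "sum y K \<le> T" "0 \<le> surplus V E 0 c y" "0 < sum y V" "1 / 2 < c"
  obtains z where "\<And>v. v \<in> V \<Longrightarrow> 0 \<le> z v \<and> z v \<le> 1" "\<And>v. v \<notin> K \<Longrightarrow> z v = y v"
    "sum z K \<le> T" "0 \<le> surplus V E 0 c z" "0 < sum z V" "sum z K = T \<or> fractional V z = {}"
  using assms(1,2,4,5,6)
proof (induction "card (fractional V y)" arbitrary: y thesis rule: less_induct)
  case less
  show ?case
  proof (cases "sum y K = T \<or> fractional V y = {}")
    case True
    then show ?thesis using less.prems(1)[of y] less.prems(2-) by blast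
  next
    case False
    then obtain u where u: "u \<in> fractional V y" by auto
    then have u': "u \<in> V" "u \<in> K" "0 < y u" "y u < 1"
      using less.prems(3) by (auto simp: fractional_def)
    have finK: "finite K" using assms(3) finite_vertices finite_subset by auto
    define L where "L = link_weight V E y u - c"
    define r where "r = (if L \<le> 0 then 0 else min 1 (y u + (T - sum y K)))"
    define z where "z = y(u := r)"
    have lt: "sum y K < T" using False less.prems(4) by auto
    have r01: "0 \<le> r" "r \<le> 1" using u' lt by (auto simp: r_def)
    have sumK: "sum z K = sum y K + r - y u"
      unfolding z_def using sum_fun_upd[OF finK u'(2), of "\<lambda>_ r. r" y r] by simp
    have sumV: "sum z V = sum y V + r - y u"
      unfolding z_def using sum_fun_upd[OF finite_vertices u'(1), of "\<lambda>_ r. r" y r] by simp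
    have zK: "sum z K \<le> T" unfolding sumK r_def using lt u' by auto
    have "surplus V E 0 c z = surplus V E 0 c y + (r - y u) * L"
      using surplus_update[OF u'(1), of 0 c y "r - y u"] by (simp add: z_def L_def)
    moreover have "0 \<le> (r - y u) * L"
      using u' lt by (auto simp: r_def intro!: mult_nonneg_nonpos)
    ultimately have zs: "0 \<le> surplus V E 0 c z" using less.prems(5) by simp
    have "2 * c \<le> sum y V"
      using sum_ge_if_surplus_nonneg[OF _ less.prems(5,6)] less.prems(2) by blast
    then have "1 < sum y V" using assms(7) by simp
    then have zV: "0 < sum z V" unfolding sumV using r01 u' by simp
    have z01: "0 \<le> z v \<and> z v \<le> 1" if "v \<in> V" for v
      using r01 less.prems(2)[OF that] by (simp add: z_def)
    have sub: "fractional V z \<subseteq> fractional V y"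
      using u unfolding fractional_def z_def by auto
    show ?thesis
    proof (cases "r \<in> {0, 1}")
      case True
      then have "u \<notin> fractional V z" by (auto simp: fractional_def z_def)
      then have "fractional V z \<subset> fractional V y" using sub u by auto
      moreover have "finite (fractional V y)" using finite_vertices by (simp add: fractional_def)
      ultimately have lt: "card (fractional V z) < card (fractional V y)" by (rule psubset_card_mono[rotated])
      have zfr: "fractional V z \<subseteq> K" using sub less.prems(3) by auto
      obtain z' where "\<And>v. v \<in> V \<Longrightarrow> 0 \<le> z' v \<and> z' v \<le> 1" "\<And>v. v \<notin> K \<Longrightarrow> z' v = z v"
        "sum z' K \<le> T" "0 \<le> surplus V E 0 c z'" "0 < sum z' V" "sum z' K = T \<or> fractional V z' = {}"
        using less.hyps[OF lt _ z01 zfr zK zs zV] by metis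
      moreover have "z v = y v" if "v \<notin> K" for v using that u' by (auto simp: z_def)
      ultimately show ?thesis using less.prems(1)[of z'] by simp
    next
      case False
      then have "r = y u + (T - sum y K)" by (auto simp: r_def min_def split: if_splits)
      then have "sum z K = T" unfolding sumK by simp
      moreover have "z v = y v" if "v \<notin> K" for v using that u' by (auto simp: z_def)
      ultimately show ?thesis using less.prems(1)[of z] z01 zK zs zV by blast
    qed
  qed
qed

section \<open>Assigning the last vertex\<close>

text \<open>
  The three lemmas of this part are about the real numbers that describe a partition of all vertices
  but u.  Here a = |A|, b = |B|, f = ||A|| - s|A|, g = ||B|| - t|B|, th is the share of u in A, and yA, yB
  are the numbers of neighbours of u in A and B minus p\<rho> and q\<rho>, where N = 2\<rho> + 1.  Adding u to A
  changes f by yA + (q + pd), adding u to B changes g by yB + (p + qd).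

  If B alone violates (2), then its reserve is outweighed by its debt to u, which is possible only for
  th < q(1 - d).  So small a th keeps f non-negative.  For the choice B + u, (3) follows from the lower
  bounds on the sizes if th \<le> q(1 - 2d), and otherwise from the large size of B that the violation of
  (2) forces.
\<close>

lemma assign_to_B_if_B_short:
  fixes p q d N a b th f g yA yB :: real
  assumes pq: "0 < p" "0 < q" "p + q = 1" and d: "0 \<le> d" "d \<le> 1 / 2"
    and N: "2 \<le> p * N" "2 \<le> q * N" and th: "0 \<le> th" "th \<le> 1"
    and F: "f \<ge> (q + p * d) * a - th * yA - p * q * N / 2 + th * (1 - th) / 2"
    and G: "g \<ge> (p + q * d) * b - (1 - th) * yB - p * q * N / 2 + th * (1 - th) / 2"
    and yA: "yA \<le> a - p * (N - 1) / 2" and yB: "0 \<le> yB" "yB \<le> b - q * (N - 1) / 2"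
    and A: "p * N \<le> a + th" and B: "q * N \<le> b + (1 - th)" and g: "g < 0"
  shows "0 \<le> f \<and> d * (a + b + 1) - 1 \<le> f + g + yB + (p + q * d)"
proof -
  define A' where "A' = a + th"
  define B' where "B' = b + (1 - th)"
  define k where "k = q * (1 - d)"
  define e where "e = th - q * (1 - 2 * d)"
  have p: "p = 1 - q" using pq by simp
  have "0 < p * N" using N by linarith
  then have N0: "0 \<le> N" using pq by (simp add: zero_less_mult_iff)
  have ab: "a = A' - th" "b = B' - (1 - th)" by (simp_all add: A'_def B'_def)
  have AB: "p * N \<le> A'" "q * N \<le> B'" using A B by (simp_all add: A'_def B'_def)
  have kq: "k \<le> q" using pq d by (simp add: k_def)
  have "(1 - th) * yB \<le> (1 - th) * (b - q * (N - 1) / 2)"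
    using yB th by (intro mult_left_mono) auto
  then have g2: "2 * g \<ge> 2 * (th - k) * B' + (q - th) * q * N - (1 - th) * e"
    using G unfolding ab p k_def e_def by (simp add: field_simps)
  \<comment> \<open>for th \<ge> k the reserve of B covers its debt to u, because B has at least the size qN - (1 - th)\<close>
  have thk: "th < k"
  proof (rule ccontr)
    assume "\<not> th < k"
    then have *: "th - k \<ge> 0" by simp
    have "(th - k) * (q * N) \<le> (th - k) * B'" using * AB by (intro mult_left_mono) auto
    then have "2 * g \<ge> e * (q * N - (1 - th))"
      using g2 unfolding e_def k_def by (simp add: algebra_simps)
    moreover have "0 \<le> q * d" using pq d by simp
    then have "0 \<le> e" using * unfolding e_def k_def by (simp add: algebra_simps)
    ultimately have "0 \<le> 2 * g" using N th by (smt (verit) mult_nonneg_nonneg)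
    then show False using g by simp
  qed
  have tq: "th < q" using thk kq by simp
  have yA': "th * yA \<le> th * (a - p * (N - 1) / 2)"
    using yA th by (intro mult_left_mono) auto
  have f: "0 \<le> f"
  proof -
    have "0 \<le> p * d * a" using pq d A N th by (intro mult_nonneg_nonneg) auto
    moreover have "(q - th) * (p * N) \<le> (q - th) * A'" using tq AB by (intro mult_left_mono) auto
    ultimately have "2 * f \<ge> (q - th) * (p * N - th)"
      using F yA' unfolding ab p by (simp add: field_simps)
    moreover have "0 \<le> (q - th) * (p * N - th)"
      using tq N th by (intro mult_nonneg_nonneg) auto
    ultimately show ?thesis by simp
  qed
  \<comment> \<open>the slack in (3)\<close>
  define S where "S = f + g + yB + (p + q * d) - d * (a + b + 1) + 1"
  have S: "2 * S \<ge> - p * N * (2 * q * d + th) + 2 * p * (1 - d) * B' + 1"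
  proof -
    have 1: "(k - th) * (p * N) \<le> (k - th) * A'" using thk AB by (intro mult_left_mono) auto
    have 2: "0 \<le> th * yB" using th yB by simp
    define R where "R = (q + p * d) * a - th * yA + (p + q * d) * (b + 1) - d * (a + b + 1)
         + th * yB - p * q * N + th * (1 - th) + 1"
    have "S - R = (f - ((q + p * d) * a - th * yA - p * q * N / 2 + th * (1 - th) / 2))
        + (g - ((p + q * d) * b - (1 - th) * yB - p * q * N / 2 + th * (1 - th) / 2))"
      unfolding S_def R_def by (simp add: field_simps)
    also have "\<dots> \<ge> 0" using F G by (intro add_nonneg_nonneg) simp_all
    finally have "2 * S \<ge> 2 * R" by simp
    also have "2 * R = 2 * (k * a - th * yA + p * (1 - d) * (b + 1) + th * yB - p * q * N + th * (1 - th) + 1)"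
      unfolding R_def k_def p by (simp add: algebra_simps)
    finally have "2 * S \<ge> 2 * (k * a - th * (a - p * (N - 1) / 2) + p * (1 - d) * (b + 1)
        - p * q * N + th * (1 - th) + 1)"
      using yA' 2 by simp
    also have "2 * (k * a - th * (a - p * (N - 1) / 2) + p * (1 - d) * (b + 1)
        - p * q * N + th * (1 - th) + 1) = 2 * ((k - th) * A') - 2 * (k - th) * th
        + th * p * (N - 1) + 2 * p * (1 - d) * (B' + th) - 2 * p * q * N + 2 * th * (1 - th) + 2"
      unfolding ab by (simp add: field_simps)
    finally have 3: "2 * S \<ge> 2 * ((k - th) * (p * N)) - 2 * (k - th) * th
        + th * p * (N - 1) + 2 * p * (1 - d) * (B' + th) - 2 * p * q * N + 2 * th * (1 - th) + 2"
      using 1 by simp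
    have 4: "th * k \<le> th" "th * p \<le> 1" "0 \<le> p * (1 - d) * th"
      using th pq kq d by (auto intro!: mult_left_le mult_le_one mult_nonneg_nonneg)
    show ?thesis using 3 4 unfolding k_def by (simp add: algebra_simps)
  qed
  have "0 \<le> S"
  proof (cases "e \<le> 0")
    case True
    have "2 * p * (1 - d) * (q * N) \<le> 2 * p * (1 - d) * B'"
      using AB pq d by (intro mult_left_mono) auto
    then have "2 * S \<ge> p * N * (q * (1 - 2 * d) - e) + 1"
      using S unfolding e_def by (simp add: algebra_simps)
    moreover have "0 \<le> p * N * (q * (1 - 2 * d) - e)"
      using True N0 pq d by (intro mult_nonneg_nonneg) (auto intro: order_trans[of _ 0])
    ultimately show ?thesis by simp
  next
    case False
    \<comment> \<open>this is where the violation of (2) is used: B' exceeds its lower bound qN by enough to make up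
       for the loss th * p * N in S\<close>
    have "2 * (k - th) * (B' - q * N) > e * (q * N - (1 - th))"
      using g2 g unfolding e_def k_def by (simp add: algebra_simps)
    moreover have "th * (B' - q * N) \<ge> 0" using th AB by simp
    ultimately have "2 * k * (B' - q * N) \<ge> e * (q * N) - e * (1 - th)"
      by (simp add: algebra_simps)
    then have "(p / q) * (e * (q * N) - e * (1 - th)) \<le> (p / q) * (2 * k * (B' - q * N))"
      using pq by (intro mult_left_mono) auto
    moreover have "(p / q) * (2 * k * (B' - q * N)) = 2 * p * (1 - d) * (B' - q * N)"
      using pq unfolding k_def by simp
    moreover have "(p / q) * (e * (q * N) - e * (1 - th)) = p * e * N - (p / q) * e * (1 - th)"
      using pq by (simp add: field_simps)
    ultimately have 5: "p * e * N - (p / q) * e * (1 - th) \<le> 2 * p * (1 - d) * (B' - q * N)"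
      by linarith
    have "e \<le> q * d" using thk unfolding e_def k_def by (simp add: algebra_simps)
    then have "e * (1 - th) \<le> q * d * 1" using th False pq d by (intro mult_mono) auto
    then have "(p / q) * (e * (1 - th)) \<le> (p / q) * (q * d * 1)"
      using pq by (intro mult_left_mono) auto
    then have "(p / q) * e * (1 - th) \<le> p * d"
      using pq by simp
    also have "p * d \<le> 1" using pq d by (intro mult_le_one) auto
    finally have 6: "2 * p * (1 - d) * (B' - q * N) \<ge> p * e * N - 1" using 5 by simp
    have "2 * S \<ge> p * N * (q * (1 - 2 * d))"
      using S 6 unfolding e_def by (simp add: algebra_simps)
    moreover have "0 \<le> p * N * (q * (1 - 2 * d))"
      using N0 pq d by (intro mult_nonneg_nonneg) auto
    ultimately show ?thesis by simp
  qed
  then show ?thesis using f unfolding S_def by simp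
qed

text \<open>
  If u has at most q\<rho> neighbours in B, then B loses nothing by giving up its share of u.
\<close>

lemma assign_to_A_if_link_to_B_weak:
  fixes p q d N a b th f g yA yB :: real
  assumes pq: "0 < p" "0 < q" "p + q = 1" and d: "0 \<le> d" "d \<le> 1 / 2"
    and N: "2 \<le> p * N" "2 \<le> q * N" and th: "0 \<le> th" "th \<le> 1"
    and F: "f \<ge> (q + p * d) * a - th * yA - p * q * N / 2 + th * (1 - th) / 2"
    and G: "g \<ge> (p + q * d) * b - (1 - th) * yB - p * q * N / 2 + th * (1 - th) / 2"
    and yA: "0 \<le> yA" and yB: "yB \<le> 0"
    and A: "p * N \<le> a + th" and B: "q * N \<le> b + (1 - th)"
  shows "0 \<le> f + yA + (q + p * d) \<and> 0 \<le> g \<and> d * (a + b + 1) - 1 \<le> (f + yA + (q + p * d)) + g"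
proof -
  have p: "p = 1 - q" using pq by simp
  have tt: "0 \<le> th * (1 - th)" using th by simp
  have ab: "a \<ge> 1" "b \<ge> 1" using A B N th by auto
  have ty: "0 \<le> (1 - th) * yA" "(1 - th) * yB \<le> 0"
    using th yA yB by (auto intro: mult_nonneg_nonpos)
  have pqda: "0 \<le> p * d * (a + 1)" "0 \<le> q * d * b" using pq d ab by auto
  have p2: "p * 2 \<le> p * (q * N)" using N pq by (auto intro!: mult_left_mono)
  have pqN0: "0 \<le> p * q * N" using p2 pq by (simp add: mult.assoc)
  have "q * (p * N) \<le> q * (a + 1)"
    using A th pq by (intro mult_left_mono) auto
  then have "0 \<le> q * (a + 1) - p * q * N / 2" using pqN0 by (simp add: algebra_simps)
  moreover have "f + yA + (q + p * d) = (f - ((q + p * d) * a - th * yA - p * q * N / 2 + th * (1 - th) / 2))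
      + (q * (a + 1) - p * q * N / 2) + p * d * (a + 1) + (1 - th) * yA + th * (1 - th) / 2"
    by (simp add: field_simps)
  ultimately have R1: "0 \<le> f + yA + (q + p * d)"
    using F ty tt pqda by linarith
  have "p * (q * N) \<le> p * (b + (1 - th))" "p * (1 - th) \<le> p"
    using B pq th by (auto intro!: mult_left_mono mult_left_le)
  then have "0 \<le> p * b - p * q * N / 2" using p2 by (simp add: algebra_simps)
  moreover have "g = (g - ((p + q * d) * b - (1 - th) * yB - p * q * N / 2 + th * (1 - th) / 2))
      + (p * b - p * q * N / 2) + q * d * b - (1 - th) * yB + th * (1 - th) / 2"
    by (simp add: field_simps)
  ultimately have R2: "0 \<le> g"
    using G ty tt pqda by linarith
  have "d * (a + b + 1) - 1 \<le> (f + yA + (q + p * d)) + g"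
  proof -
    have 1: "q * (1 - d) * (p * N) \<le> q * (1 - d) * (a + 1)"
      using A th pq d by (intro mult_left_mono) auto
    have 2: "p * (1 - d) * (q * N - (1 - th)) \<le> p * (1 - d) * b"
      using B pq d by (intro mult_left_mono) auto
    have 3: "p * (1 - d) * (1 - th) \<le> 1"
      using pq d th by (intro mult_le_one) auto
    have "0 \<le> p * (q * N)" using p2 pq by linarith
    then have 4: "0 \<le> (1 - 2 * d) * (p * (q * N))"
      using d mult_nonneg_nonneg[of "1 - 2 * d" "p * (q * N)"] by simp
    have "f + yA + (q + p * d) + g - (d * (a + b + 1) - 1)
        = (f - ((q + p * d) * a - th * yA - p * q * N / 2 + th * (1 - th) / 2))
        + (g - ((p + q * d) * b - (1 - th) * yB - p * q * N / 2 + th * (1 - th) / 2))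
        + (q * (1 - d) * (a + 1) - q * (1 - d) * (p * N))
        + (p * (1 - d) * b - p * (1 - d) * (q * N - (1 - th)))
        + (1 - p * (1 - d) * (1 - th)) + (1 - 2 * d) * (p * (q * N))
        + (1 - th) * yA - (1 - th) * yB + th * (1 - th)"
      unfolding p by (simp add: field_simps)
    also have "\<dots> \<ge> 0"
      using F G 1 2 3 4 ty tt by linarith
    finally show ?thesis by simp
  qed
  then show ?thesis using R1 R2 by simp
qed

text \<open>
  Unless one of A, B is short without u, both choices satisfy (1) and (2).  With weights 1 - th and th the
  slacks SL, SR of the two choices in (3) have a positive combination, so one of them is non-negative.
  Here 2(1 - d) \<ge> 1 is needed: the reserves left after paying d per vertex are (1 - d)q and (1 - d)p,
  they add up to at least 2(1 - d)pqN, and the rounding has cost pqN.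
\<close>

lemma assign_last_vertex:
  fixes p q d N a b th f g yA yB :: real
  assumes pq: "0 < p" "0 < q" "p + q = 1" and d: "0 \<le> d" "d \<le> 1 / 2"
    and N: "2 \<le> p * N" "2 \<le> q * N" and th: "0 \<le> th" "th \<le> 1"
    and F: "f \<ge> (q + p * d) * a - th * yA - p * q * N / 2 + th * (1 - th) / 2"
    and G: "g \<ge> (p + q * d) * b - (1 - th) * yB - p * q * N / 2 + th * (1 - th) / 2"
    and yA: "yA \<le> a - p * (N - 1) / 2" and yB: "yB \<le> b - q * (N - 1) / 2"
    and y: "0 \<le> yA \<or> 0 \<le> yB"
    and A: "p * N \<le> a + th" and B: "q * N \<le> b + (1 - th)"
  shows "0 \<le> f \<and> 0 \<le> g + yB + (p + q * d) \<and> d * (a + b + 1) - 1 \<le> f + (g + yB + (p + q * d))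
       \<or> 0 \<le> f + yA + (q + p * d) \<and> 0 \<le> g \<and> d * (a + b + 1) - 1 \<le> (f + yA + (q + p * d)) + g"
proof -
  have F': "f \<ge> (q + p * d) * a - (1 - (1 - th)) * yA - q * p * N / 2 + (1 - th) * (1 - (1 - th)) / 2"
    and G': "g \<ge> (p + q * d) * b - (1 - th) * yB - q * p * N / 2 + (1 - th) * (1 - (1 - th)) / 2"
    using F G by (simp_all add: algebra_simps)
  have d': "d * (b + a + 1) = d * (a + b + 1)" by (simp add: algebra_simps)
  have tt: "0 \<le> th * (1 - th)" using th by simp
  have ab: "a \<ge> 1" "b \<ge> 1" using A B N th by auto
  have pqN: "p * (q * N) \<le> p * (b + (1 - th))" "q * (p * N) \<le> q * (a + th)"
    using A B pq by (auto intro!: mult_left_mono)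
  have pqd: "0 \<le> p * d" "0 \<le> q * d" using pq d by auto
  have pqda: "0 \<le> p * d * a" "0 \<le> q * d * b" using pqd ab by auto
  have p2: "p * 2 \<le> p * (q * N)" "q * 2 \<le> q * (p * N)" using N pq by (auto intro!: mult_left_mono)
  have pqN0: "0 \<le> p * q * N" using p2 pq by (simp add: mult.assoc)
  have avg: "p * q * N \<le> q * (1 - d) * (a + th) + p * (1 - d) * (b + (1 - th))"
  proof -
    have "q * (1 - d) * (p * N) \<le> q * (1 - d) * (a + th)"
      using A pq d by (intro mult_left_mono) auto
    moreover have "p * (1 - d) * (q * N) \<le> p * (1 - d) * (b + (1 - th))"
      using B pq d by (intro mult_left_mono) auto
    moreover have "0 \<le> p * (q * N)" using p2 pq by linarith
    then have "0 \<le> (1 - 2 * d) * (p * (q * N))"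
      using d mult_nonneg_nonneg[of "1 - 2 * d" "p * (q * N)"] by simp
    ultimately show ?thesis by (simp add: algebra_simps)
  qed
  define SL where "SL = f + (g + yB + (p + q * d)) - (d * (a + b + 1) - 1)"
  define SR where "SR = (f + yA + (q + p * d)) + g - (d * (a + b + 1) - 1)"
  have sum: "(1 - th) * SL + th * SR \<ge> th * (1 - th)"
  proof -
    have p: "p = 1 - q" using pq by simp
    have "(1 - th) * SL + th * SR - th * (1 - th)
        = (f - ((q + p * d) * a - th * yA - p * q * N / 2 + th * (1 - th) / 2))
        + (g - ((p + q * d) * b - (1 - th) * yB - p * q * N / 2 + th * (1 - th) / 2))
        + (q * (1 - d) * (a + th) + p * (1 - d) * (b + (1 - th)) - p * q * N) + 1"
      unfolding SL_def SR_def p by (simp add: field_simps)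
    also have "\<dots> \<ge> 0" using F G avg by linarith
    finally show ?thesis by simp
  qed
  show ?thesis
  proof (cases "yA < 0 \<or> yB < 0")
    case True
    then consider "yB < 0" "0 \<le> yA" | "yA < 0" "0 \<le> yB" using y by linarith
    then show ?thesis
    proof cases
      case 1
      then show ?thesis using assign_to_A_if_link_to_B_weak[OF pq d N th F G _ _ A B] by simp
    next
      case 2
      have "q + p = 1" "1 - th \<ge> 0" "1 - th \<le> 1" "p * N \<le> a + (1 - (1 - th))"
        using pq th A by auto
      then show ?thesis
        using assign_to_A_if_link_to_B_weak[OF pq(2,1) _ d N(2,1) _ _ G' F' _ _ B] 2 unfolding d' by (simp add: add_ac)
    qed
  next
    case False
    then have y0: "0 \<le> yA" "0 \<le> yB" by auto
    have ty: "0 \<le> th * yB" "0 \<le> (1 - th) * yA" using th y0 by auto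
    have RR: "0 \<le> g + yB + (p + q * d)"
    proof -
      have "p * (b + (1 - th)) \<le> p * (b + 1)" using pq th by (intro mult_left_mono) auto
      then have "0 \<le> p * (b + 1) - p * q * N / 2" using pqN pqN0 by (simp add: algebra_simps)
      moreover have "g + yB + (p + q * d) = (g - ((p + q * d) * b - (1 - th) * yB - p * q * N / 2 + th * (1 - th) / 2))
          + (p * (b + 1) - p * q * N / 2) + q * d * b + q * d + th * yB + th * (1 - th) / 2"
        by (simp add: field_simps)
      ultimately show ?thesis using G ty tt pqda pqd by linarith
    qed
    have RL: "0 \<le> f + yA + (q + p * d)"
    proof -
      have "q * (a + th) \<le> q * (a + 1)" using pq th by (intro mult_left_mono) auto
      then have "0 \<le> q * (a + 1) - p * q * N / 2" using pqN pqN0 by (simp add: algebra_simps)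
      moreover have "f + yA + (q + p * d) = (f - ((q + p * d) * a - th * yA - p * q * N / 2 + th * (1 - th) / 2))
          + (q * (a + 1) - p * q * N / 2) + p * d * a + p * d + (1 - th) * yA + th * (1 - th) / 2"
        by (simp add: field_simps)
      ultimately show ?thesis using F ty tt pqda pqd by linarith
    qed
    show ?thesis
    proof (cases "g < 0 \<or> f < 0")
      case True
      then show ?thesis
      proof
        assume "g < 0"
        then show ?thesis using assign_to_B_if_B_short[OF pq d N th F G yA y0(2) yB A B] RR by auto
      next
        assume "f < 0"
        moreover have "q + p = 1" "1 - th \<ge> 0" "1 - th \<le> 1" "p * N \<le> a + (1 - (1 - th))"
          using pq th A by auto
        ultimately show ?thesis
          using assign_to_B_if_B_short[OF pq(2,1) _ d N(2,1) _ _ G' F' yB y0(1) yA B] RL unfolding d' by (auto simp: algebra_simps)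
      qed
    next
      case False
      have "0 \<le> SL \<or> 0 \<le> SR"
      proof (rule ccontr)
        assume "\<not> (0 \<le> SL \<or> 0 \<le> SR)"
        then have "SL < 0" "SR < 0" by auto
        then have "(1 - th) * SL + th * SR < 0"
          using th by (smt (verit) mult_nonneg_nonpos mult_pos_neg)
        then show False using sum tt by linarith
      qed
      then show ?thesis using False RL RR unfolding SL_def SR_def by auto
    qed
  qed
qed

section \<open>Minimal dense graphs\<close>

definition good_split :: "'a set \<Rightarrow> 'a set set \<Rightarrow> real \<Rightarrow> real \<Rightarrow> bool" where
  "good_split V E s t \<longleftrightarrow> (\<exists>A B. A \<subseteq> V \<and> B \<subseteq> V \<and> A \<inter> B = {} \<and> A \<noteq> {} \<and> B \<noteq> {}
    \<and> real (num_edges E A) - s * real (card A) \<ge> 0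
    \<and> real (num_edges E B) - t * real (card B) \<ge> 0
    \<and> (real (num_edges E A) - s * real (card A)) + (real (num_edges E B) - t * real (card B))
        \<ge> excess E s t (A \<union> B) - 1)"

lemma good_split_commute: "good_split V E s t \<longleftrightarrow> good_split V E t s"
proof -
  have "good_split V E t s" if "good_split V E s t" for s t
  proof -
    from that obtain A B where AB: "A \<subseteq> V" "B \<subseteq> V" "A \<inter> B = {}" "A \<noteq> {}" "B \<noteq> {}"
      "real (num_edges E A) - s * real (card A) \<ge> 0" "real (num_edges E B) - t * real (card B) \<ge> 0"
      "(real (num_edges E A) - s * real (card A)) + (real (num_edges E B) - t * real (card B))
        \<ge> excess E s t (A \<union> B) - 1"
      unfolding good_split_def by blast
    have "excess E t s (B \<union> A) = excess E s t (A \<union> B)"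
      by (simp add: excess_def Un_commute add.commute)
    then show ?thesis
      unfolding good_split_def using AB by (intro exI[of _ B] exI[of _ A]) (auto simp: Int_commute)
  qed
  then show ?thesis by blast
qed

text \<open>
  The weight with which every vertex belongs to A at the start.  The value is chosen such
  that, with p = share s t and q = share t s, both p\<rho> = s + q + pd and q\<rho> = t + p + qd.  A clique of order
  2s + 1 has exactly s edges per vertex, and pN = 2s + 1 + q + 2pd leaves room for one rounding step.
\<close>

definition share :: "real \<Rightarrow> real \<Rightarrow> real" where
  "share s t = (s + 1) / (s + t + 2)"

text \<open>
  A smallest non-empty vertex set with non-negative h, as a graph of its own.  The roles of s and t can be
  exchanged, which is used through \<open>swap\<close>.
\<close>

locale dense_core = finite_simple_graph V E for V :: "'a set" and E :: "'a set set" +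
  fixes s t :: real
  assumes s: "1 / 2 < s" and t: "1 / 2 < t" and nonempty: "V \<noteq> {}"
    and dense: "(s + t + 1) * real (card V) \<le> real (num_edges E V)"
    and sparse: "\<And>X. X \<subseteq> V \<Longrightarrow> X \<noteq> {} \<Longrightarrow> X \<noteq> V \<Longrightarrow> real (num_edges E X) < (s + t + 1) * real (card X)"
begin

abbreviation "n \<equiv> real (card V)"
definition "dens = real (card E) / n"
abbreviation "p \<equiv> share s t"
abbreviation "q \<equiv> share t s"
abbreviation "N \<equiv> 2 * dens + 1"
abbreviation "d \<equiv> dens - (s + t + 1)"
abbreviation "deg v \<equiv> link_weight V E (\<lambda>_. 1) v"

lemma swap: "dense_core V E t s"
  by unfold_locales (use s t nonempty dense sparse in \<open>auto simp: add.commute\<close>)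

lemma n_pos: "0 < n"
  using nonempty finite_vertices by (simp add: card_gt_0_iff)

lemma num_edges_all: "num_edges E V = card E"
  unfolding num_edges_def induced_edges_def using edge_subset by (metis (no_types, lifting) Collect_cong Collect_mem_eq)

lemma edges_eq: "real (card E) = dens * n"
  using n_pos by (simp add: dens_def)

lemma d_nonneg: "0 \<le> d"
  using dense n_pos by (simp add: num_edges_all dens_def field_simps)

lemma shares: "0 < p" "0 < q" "p + q = 1" "p < 1" "q < 1"
proof -
  have "p = (s + 1) / (s + t + 2)" "q = (t + 1) / (s + t + 2)"
    by (simp_all add: share_def add.commute[of t s])
  note eqs = this
  show "p + q = 1"
    unfolding eqs add_divide_distrib[symmetric] using s t by (simp add: divide_simps)
  show "0 < p" "0 < q" "p < 1" "q < 1"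
    unfolding eqs using s t by simp_all
qed

lemma p_dens: "p * dens = s + q + p * d"
proof -
  have "p * (s + t + 2) = s + 1" using s t by (simp add: share_def)
  then have "p * (s + t + 1) = s + q" using shares(3) by (simp add: algebra_simps)
  then show ?thesis by (simp add: algebra_simps)
qed

lemma q_dens: "q * dens = t + p + q * d"
proof -
  have "q * (s + t + 2) = t + 1" using s t by (simp add: share_def field_simps)
  then have "q * (s + t + 1) = t + p" using shares(3) by (simp add: algebra_simps)
  then show ?thesis by (simp add: algebra_simps)
qed

lemma pN: "p * N = 2 * (p * dens) + p" and qN: "q * N = 2 * (q * dens) + q"
  by (simp_all add: algebra_simps)

lemma p_dens_gt: "s + q \<le> p * dens" and q_dens_gt: "t + p \<le> q * dens"
  using p_dens q_dens d_nonneg shares by auto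

lemma card_ge2: "2 \<le> card V"
proof (rule ccontr)
  assume "\<not> 2 \<le> card V"
  then have "card V = 1" using n_pos by simp
  moreover have "2 * real (card E) \<le> n\<^sup>2 - n"
    using edge_weight_le[of "\<lambda>_. 1"] by (simp add: edge_weight_def)
  ultimately have "card E = 0" by simp
  then show False using dense n_pos s t by (simp add: num_edges_all mult_le_0_iff)
qed

text \<open>
  Deleting v makes h negative.
\<close>

lemma deg_gt:
  assumes "v \<in> V"
  shows "dens + d * (n - 1) < deg v"
proof -
  have "V - {v} \<noteq> {}"
    using card_ge2 assms by (metis Diff_eq_empty_iff card_1_singleton_iff card_mono finite.intros finite_insert is_singletonI is_singleton_altdef not_less_eq_eq numeral_2_eq_2)
  then have "real (num_edges E (V - {v})) < (s + t + 1) * real (card (V - {v}))"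
    using assms by (intro sparse) auto
  also have "real (card (V - {v})) = n - 1"
    using assms finite_vertices n_pos by (simp add: card_Diff_singleton of_nat_diff Suc_leI card_gt_0_iff)
  also have "real (num_edges E (V - {v})) = edge_weight E ((\<lambda>_. 1)(v := 0))"
    unfolding edge_weight_of_bool[symmetric] by (rule edge_weight_cong) auto
  also have "\<dots> = real (card E) - deg v"
    unfolding edge_weight_update[OF assms] by (simp add: edge_weight_def)
  finally show ?thesis unfolding edges_eq by (simp add: algebra_simps)
qed

lemma deg_gt_dens:
  assumes "v \<in> V"
  shows "dens < deg v"
proof -
  have "0 \<le> d * (n - 1)" using d_nonneg card_ge2 by (intro mult_nonneg_nonneg) auto
  then show ?thesis using deg_gt[OF assms] by simp
qed

lemma deg_le:
  assumes "v \<in> V"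
  shows "deg v \<le> n - 1"
  using link_weight_le[of "\<lambda>_. 1" v] assms by simp

lemma sum_deg: "sum deg V = 2 * (dens * n)"
  using edge_weight_handshake[of "\<lambda>_. 1"] by (simp add: edge_weight_def edges_eq)

text \<open>
  Summing the degree bound gives d(n - 1) < \<rho>, while \<rho> \<le> (n - 1)/2 because the graph is simple.
\<close>

lemma d_le_half: "d \<le> 1 / 2"
proof -
  have "(\<Sum>v\<in>V. dens + d * (n - 1)) < sum deg V"
    using finite_vertices nonempty deg_gt by (intro sum_strict_mono) auto
  then have "n * (dens + d * (n - 1)) < n * (2 * dens)"
    unfolding sum_deg by (simp add: algebra_simps)
  then have 1: "d * (n - 1) < dens" using n_pos by simp
  have "sum deg V \<le> (\<Sum>v\<in>V. n - 1)" using deg_le by (intro sum_mono)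
  then have "n * (2 * dens) \<le> n * (n - 1)" unfolding sum_deg by (simp add: algebra_simps)
  then have "2 * dens \<le> n - 1" using n_pos by simp
  with 1 have "d * (n - 1) < 1 / 2 * (n - 1)" by simp
  then show ?thesis using card_ge2 by (simp only: mult_less_cancel_right) auto
qed

text \<open>
  A clique on more than 2\<rho> + 1 vertices has more than \<rho> edges per vertex, but no subgraph of the core
  is denser than the core.
\<close>

lemma clique_card_le:
  assumes "K \<subseteq> V" "\<And>u v. u \<in> K \<Longrightarrow> v \<in> K \<Longrightarrow> u \<noteq> v \<Longrightarrow> {u, v} \<in> E"
  shows "real (card K) \<le> N"
proof (cases "K = {}")
  case True
  then show ?thesis using d_nonneg s t by simp
next
  case False
  let ?x = "\<lambda>v. of_bool (v \<in> K) :: real"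
  have "finite K" using assms(1) finite_vertices finite_subset by auto
  then have k: "0 < real (card K)" using False by (simp add: card_gt_0_iff)
  have "V \<inter> K = K" using assms(1) by auto
  then have "sum ?x V = real (card K)"
    using finite_vertices by (simp add: of_bool_def sum.If_cases)
  moreover have "(\<Sum>v\<in>V. (?x v)\<^sup>2) = sum ?x V" by (rule sum.cong) auto
  ultimately have sum: "sum ?x V = real (card K)" "(\<Sum>v\<in>V. (?x v)\<^sup>2) = real (card K)" by simp_all
  have "2 * real (num_edges E K) = (real (card K))\<^sup>2 - real (card K)"
    using edge_weight_clique[OF assms, of ?x] unfolding sum edge_weight_of_bool by simp
  moreover have "real (num_edges E K) \<le> dens * real (card K)"
  proof (cases "K = V")
    case True
    then show ?thesis using edges_eq num_edges_all by simp
  next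
    case neq: False
    have "(s + t + 1) * real (card K) \<le> dens * real (card K)"
      using d_nonneg by (intro mult_right_mono) auto
    then show ?thesis using sparse[OF assms(1) False neq] by simp
  qed
  ultimately have "real (card K) * real (card K) \<le> real (card K) * N"
    by (simp add: power2_eq_square algebra_simps)
  then show ?thesis using k by simp
qed

text \<open>
  For X = V this is an equality, and for every other X the left-hand side is 0.
\<close>

lemma excess_le:
  assumes "X \<subseteq> V" "X \<noteq> {}"
  shows "excess E s t X \<le> d * real (card X)"
proof (cases "X = V")
  case True
  have "0 \<le> d * n" using d_nonneg by simp
  then show ?thesis
    using True by (simp add: excess_def num_edges_all edges_eq algebra_simps)
next
  case False
  have "0 \<le> d * real (card X)" using d_nonneg by simp
  then show ?thesis using sparse[OF assms False] by (simp add: excess_def)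
qed

lemma good_splitI:
  assumes "A \<subseteq> V" "B \<subseteq> V" "A \<inter> B = {}" "A \<noteq> {}" "B \<noteq> {}"
    and "0 \<le> real (num_edges E A) - s * real (card A)"
    and "0 \<le> real (num_edges E B) - t * real (card B)"
    and "d * (real (card A) + real (card B)) - 1
      \<le> (real (num_edges E A) - s * real (card A)) + (real (num_edges E B) - t * real (card B))"
  shows "good_split V E s t"
proof -
  have "finite A" "finite B" using assms(1,2) finite_vertices finite_subset by auto
  then have "real (card (A \<union> B)) = real (card A) + real (card B)"
    using assms(3) by (simp add: card_Un_disjoint)
  moreover have "excess E s t (A \<union> B) \<le> d * real (card (A \<union> B))"
    using assms by (intro excess_le) auto
  ultimately have "excess E s t (A \<union> B) - 1
      \<le> (real (num_edges E A) - s * real (card A)) + (real (num_edges E B) - t * real (card B))"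
    using assms(8) by simp
  then show ?thesis unfolding good_split_def using assms by blast
qed

lemma indicator_sums:
  assumes "A \<subseteq> V - {u}" "u \<in> V"
  shows "sum ((\<lambda>v. of_bool (v \<in> A))(u := th)) V = real (card A) + th"
    and "(\<Sum>v\<in>V. (((\<lambda>v. of_bool (v \<in> A))(u := th)) v)\<^sup>2) = real (card A) + th\<^sup>2"
    and "sum (\<lambda>v. of_bool (v \<in> A) :: real) V = real (card A)"
proof -
  have u: "u \<notin> A" using assms by auto
  have "V \<inter> A = A" using assms(1) by auto
  then have *: "(\<Sum>v\<in>V. of_bool (v \<in> A) :: real) = real (card A)"
    using finite_vertices by (simp add: of_bool_def if_distrib sum.If_cases cong: if_cong)
  then show "sum (\<lambda>v. of_bool (v \<in> A) :: real) V = real (card A)" .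
  show "sum ((\<lambda>v. of_bool (v \<in> A))(u := th)) V = real (card A) + th"
    using sum_fun_upd[OF finite_vertices assms(2), of "\<lambda>_ r. r" "\<lambda>v. of_bool (v \<in> A)" th] * u by simp
  show "(\<Sum>v\<in>V. (((\<lambda>v. of_bool (v \<in> A))(u := th)) v)\<^sup>2) = real (card A) + th\<^sup>2"
    using sum_fun_upd[OF finite_vertices assms(2), of "\<lambda>_ r. r\<^sup>2" "\<lambda>v. of_bool (v \<in> A)" th] * u
    by (simp add: of_bool_def if_distrib[of "\<lambda>x. x\<^sup>2"] cong: if_cong)
qed

text \<open>
  With z = |A| + th, the bound on the edge weight by half of z^2 - |A| - th^2 turns the hypothesis into
  (z - q)(z - pN) \<ge> 0.
\<close>

lemma size_dichotomy:
  assumes "A \<subseteq> V - {u}" "u \<in> V" "0 \<le> th" "th \<le> 1"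
    and F: "- (p * q * N / 2) + th * (1 - th) / 2
      \<le> edge_weight E ((\<lambda>v. of_bool (v \<in> A))(u := th)) - p * dens * (real (card A) + th)"
    and "q < real (card A) + th"
  shows "p * N \<le> real (card A) + th"
proof -
  let ?z = "real (card A) + th"
  have "2 * edge_weight E ((\<lambda>v. of_bool (v \<in> A))(u := th)) \<le> ?z\<^sup>2 - (real (card A) + th\<^sup>2)"
    using edge_weight_le[of "(\<lambda>v. of_bool (v \<in> A))(u := th)"] assms(3)
    unfolding indicator_sums[OF assms(1,2)] by simp
  moreover have "- (p * q * N) + th * (1 - th) \<le> 2 * edge_weight E ((\<lambda>v. of_bool (v \<in> A))(u := th)) - 2 * (p * dens * ?z)"
    using F by linarith
  ultimately have 1: "0 \<le> ?z\<^sup>2 - ?z - 2 * (p * dens * ?z) + p * q * N"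
    by (simp add: algebra_simps power2_eq_square)
  have q: "q = 1 - p" using shares by simp
  have "(?z - q) * (?z - p * N) = ?z\<^sup>2 - ?z - 2 * (p * dens * ?z) + p * q * N"
    unfolding q by (simp add: algebra_simps power2_eq_square)
  then have "0 \<le> (?z - q) * (?z - p * N)" using 1 by simp
  then show ?thesis using assms(6) by (simp add: zero_le_mult_iff)
qed

text \<open>
  The translation of \<open>assign_last_vertex\<close> to graphs.  A and B need not exhaust the vertices other than u;
  if they do not, the bound d(|A| + |B| + 1) - 1 is more than (3) asks for.
\<close>

lemma split_from_almost_integral:
  assumes AB: "A \<subseteq> V - {u}" "B \<subseteq> V - {u}" "A \<inter> B = {}" and u: "u \<in> V" and th: "0 \<le> th" "th \<le> 1"
    and F: "- (p * q * N / 2) + th * (1 - th) / 2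
      \<le> edge_weight E ((\<lambda>v. of_bool (v \<in> A))(u := th)) - p * dens * (real (card A) + th)"
    and G: "- (p * q * N / 2) + th * (1 - th) / 2
      \<le> edge_weight E ((\<lambda>v. of_bool (v \<in> B))(u := 1 - th)) - q * dens * (real (card B) + (1 - th))"
    and nontrivial: "q < real (card A) + th" "p < real (card B) + (1 - th)"
    and link: "p * dens \<le> link_weight V E (\<lambda>v. of_bool (v \<in> A)) u
      \<or> q * dens \<le> link_weight V E (\<lambda>v. of_bool (v \<in> B)) u"
  shows "good_split V E s t"
proof -
  define dA where "dA = link_weight V E (\<lambda>v. of_bool (v \<in> A)) u"
  define dB where "dB = link_weight V E (\<lambda>v. of_bool (v \<in> B)) u"
  define a where "a = real (card A)"
  define b where "b = real (card B)"
  define f where "f = real (num_edges E A) - s * a"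
  define g where "g = real (num_edges E B) - t * b"
  have uAB: "u \<notin> A" "u \<notin> B" using AB by auto
  have finAB: "finite A" "finite B" using AB finite_vertices finite_subset by (metis finite_Diff)+
  have sizeA: "p * N \<le> a + th"
    using size_dichotomy[OF AB(1) u th F nontrivial(1)] by (simp add: a_def)
  have G': "- (q * p * N / 2) + (1 - th) * (1 - (1 - th)) / 2
      \<le> edge_weight E ((\<lambda>v. of_bool (v \<in> B))(u := 1 - th)) - q * dens * (real (card B) + (1 - th))"
    using G by (simp add: mult_ac)
  have sizeB: "q * N \<le> b + (1 - th)"
    using dense_core.size_dichotomy[OF swap AB(2) u _ _ G' nontrivial(2)] th by (simp add: b_def)
  have dA_le: "dA \<le> a" unfolding dA_def a_def
    using link_weight_le[of "\<lambda>v. of_bool (v \<in> A)" u] u uAB by (simp add: indicator_sums[OF AB(1) u])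
  have dB_le: "dB \<le> b" unfolding dB_def b_def
    using link_weight_le[of "\<lambda>v. of_bool (v \<in> B)" u] u uAB by (simp add: indicator_sums[OF AB(2) u])
  have WA: "edge_weight E ((\<lambda>v. of_bool (v \<in> A))(u := r)) = real (num_edges E A) + r * dA" for r
    unfolding edge_weight_update[OF u] edge_weight_of_bool dA_def using uAB by simp
  have WB: "edge_weight E ((\<lambda>v. of_bool (v \<in> B))(u := r)) = real (num_edges E B) + r * dB" for r
    unfolding edge_weight_update[OF u] edge_weight_of_bool dB_def using uAB by simp
  have insA: "real (num_edges E (insert u A)) = real (num_edges E A) + dA"
    unfolding edge_weight_of_bool[symmetric, of "insert u A"] using WA[of 1]
    by (subst edge_weight_cong[of _ "(\<lambda>v. of_bool (v \<in> A))(u := 1)"]) auto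
  have insB: "real (num_edges E (insert u B)) = real (num_edges E B) + dB"
    unfolding edge_weight_of_bool[symmetric, of "insert u B"] using WB[of 1]
    by (subst edge_weight_cong[of _ "(\<lambda>v. of_bool (v \<in> B))(u := 1)"]) auto
  have half: "p * (N - 1) / 2 = p * dens" "q * (N - 1) / 2 = q * dens" by simp_all
  have F2: "f \<ge> (q + p * d) * a - th * (dA - p * dens) - p * q * N / 2 + th * (1 - th) / 2"
  proof -
    have "p * dens * (a + th) = (s + q + p * d) * a + th * (p * dens)"
      using p_dens by (simp add: algebra_simps)
    then show ?thesis using F unfolding WA f_def a_def[symmetric] by (simp add: algebra_simps)
  qed
  have G2: "g \<ge> (p + q * d) * b - (1 - th) * (dB - q * dens) - p * q * N / 2 + th * (1 - th) / 2"
  proof -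
    have "q * dens * (b + (1 - th)) = (t + p + q * d) * b + (1 - th) * (q * dens)"
      using q_dens by (simp add: algebra_simps)
    then show ?thesis using G unfolding WB g_def b_def[symmetric] by (simp add: algebra_simps)
  qed
  have N2: "2 \<le> p * N" "2 \<le> q * N"
    unfolding pN qN using p_dens_gt q_dens_gt shares s t by linarith+
  have y: "0 \<le> dA - p * dens \<or> 0 \<le> dB - q * dens" using link by (auto simp: dA_def dB_def)
  have "dA - p * dens \<le> a - p * (N - 1) / 2" "dB - q * dens \<le> b - q * (N - 1) / 2"
    using dA_le dB_le by simp_all
  note sides = assign_last_vertex[OF shares(1-3) d_nonneg d_le_half N2 th F2 G2 this y sizeA sizeB]
  have cA: "card (insert u A) = card A + 1" and cB: "card (insert u B) = card B + 1"
    using uAB finAB by auto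
  from sides show ?thesis
  proof
    assume L: "0 \<le> f \<and> 0 \<le> g + (dB - q * dens) + (p + q * d) \<and> d * (a + b + 1) - 1 \<le> f + (g + (dB - q * dens) + (p + q * d))"
    have g': "g + (dB - q * dens) + (p + q * d) = real (num_edges E (insert u B)) - t * real (card (insert u B))"
      unfolding insB cB g_def b_def q_dens by (simp add: algebra_simps)
    have "p * N > 1" using N2 by simp
    then have "A \<noteq> {}" using sizeA th by (auto simp: a_def)
    then show ?thesis
      using L[unfolded g'] AB u uAB
      by (intro good_splitI[of A "insert u B"]) (auto simp: f_def a_def b_def cB add_ac)
  next
    assume R: "0 \<le> f + (dA - p * dens) + (q + p * d) \<and> 0 \<le> g \<and> d * (a + b + 1) - 1 \<le> f + (dA - p * dens) + (q + p * d) + g"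
    have f': "f + (dA - p * dens) + (q + p * d) = real (num_edges E (insert u A)) - s * real (card (insert u A))"
      unfolding insA cA f_def a_def p_dens by (simp add: algebra_simps)
    have "q * N > 1" using N2 by simp
    then have "B \<noteq> {}" using sizeB th by (auto simp: b_def)
    then show ?thesis
      using R[unfolded f'] AB u uAB
      by (intro good_splitI[of "insert u A" B]) (auto simp: g_def a_def b_def cA add_ac)
  qed
qed

end

section \<open>Splitting a minimal dense graph\<close>

context dense_core
begin

text \<open>
  The right-hand side is the tangent of the concave function x(1 - x) at x = p.
\<close>

lemma variance_le: "x * (1 - x) \<le> q\<^sup>2 * x + p\<^sup>2 * (1 - x)"
proof -
  have q: "q = 1 - p" using shares by simp
  have "q\<^sup>2 * x + p\<^sup>2 * (1 - x) - x * (1 - x) = (x - p)\<^sup>2"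
    unfolding q by (simp add: algebra_simps power2_eq_square)
  then show ?thesis by (metis diff_ge_0_iff_ge zero_le_power2)
qed

lemma variance_sum_le:
  assumes "\<And>v. v \<in> V \<Longrightarrow> 0 \<le> x v \<and> x v \<le> 1" "K \<subseteq> V" "fractional V x \<subseteq> K"
    and "sum x K \<le> p * N" "(\<Sum>v\<in>K. 1 - x v) \<le> q * N"
  shows "(\<Sum>v\<in>V. x v * (1 - x v)) \<le> p * q * N"
proof -
  have q: "q = 1 - p" using shares by simp
  have "(\<Sum>v\<in>V. x v * (1 - x v)) = (\<Sum>v\<in>K. x v * (1 - x v))"
  proof (rule sum.mono_neutral_right[OF finite_vertices assms(2)], rule ballI)
    fix v assume "v \<in> V - K"
    then have "v \<in> V" "v \<notin> fractional V x" using assms(3) by auto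
    then have "x v = 0 \<or> x v = 1" using assms(1)[of v] by (auto simp: fractional_def)
    then show "x v * (1 - x v) = 0" by auto
  qed
  also have "\<dots> \<le> (\<Sum>v\<in>K. q\<^sup>2 * x v + p\<^sup>2 * (1 - x v))"
    by (intro sum_mono variance_le)
  also have "\<dots> = q\<^sup>2 * sum x K + p\<^sup>2 * (\<Sum>v\<in>K. 1 - x v)"
    by (simp add: sum.distrib sum_distrib_left)
  also have "\<dots> \<le> q\<^sup>2 * (p * N) + p\<^sup>2 * (q * N)"
    using assms(4,5) by (intro add_mono mult_left_mono) auto
  also have "\<dots> = p * q * N" unfolding q by (simp add: algebra_simps power2_eq_square)
  finally show ?thesis .
qed

lemma almost_integral:
  assumes "\<forall>v\<in>V. 0 \<le> y v \<and> y v \<le> 1" "fractional V y \<subseteq> {u}" "u \<in> V"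
  defines "B \<equiv> {v \<in> V - {u}. y v = 1}"
  shows "\<And>v. v \<in> V \<Longrightarrow> y v = ((\<lambda>v. of_bool (v \<in> B))(u := y u)) v"
    and "sum y V = real (card B) + y u"
    and "(\<Sum>v\<in>V. y v * (1 - y v)) = y u * (1 - y u)"
proof -
  show eq: "y v = ((\<lambda>v. of_bool (v \<in> B))(u := y u)) v" if "v \<in> V" for v
    using assms(1)[rule_format, OF that] assms(2) that by (force simp: B_def fractional_def)
  have "sum y V = sum ((\<lambda>v. of_bool (v \<in> B))(u := y u)) V" using eq by (rule sum.cong[OF refl])
  then show "sum y V = real (card B) + y u"
    using indicator_sums(1)[of B u "y u"] assms(3) by (auto simp: B_def)
  have "(\<Sum>v\<in>V. y v * (1 - y v)) = (\<Sum>v\<in>{u}. y v * (1 - y v))"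
  proof (rule sum.mono_neutral_right[OF finite_vertices], goal_cases)
    case 1
    then show ?case using assms(3) by simp
  next
    case 2
    show ?case
    proof
      fix v assume "v \<in> V - {u}"
      then show "y v * (1 - y v) = 0" using eq[of v] by (auto simp del: mult_eq_0_iff simp: of_bool_def)
    qed
  qed
  then show "(\<Sum>v\<in>V. y v * (1 - y v)) = y u * (1 - y u)" by simp
qed

lemma weight_sum: "(\<Sum>v\<in>V. (deg v - dens) * x v) = (\<Sum>v\<in>V. deg v * x v) - dens * sum x V"
  by (simp add: left_diff_distrib sum_subtractf sum_distrib_left)

text \<open>
  The weights deg v - \<rho> are those for which G - F is constant, and the hypothesis \<open>balance\<close> says that
  this constant is 0.  Since the weights are positive and less than n, balance also prevents the
  rounding from ending with an almost empty A or B.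
\<close>

lemma split_small_clique:
  assumes x: "\<And>v. v \<in> V \<Longrightarrow> 0 \<le> x v \<and> x v \<le> 1"
    and balance: "(\<Sum>v\<in>V. (deg v - dens) * x v) = p * dens * n"
    and surplus: "0 \<le> surplus V E 0 (p * dens) x"
    and var: "(\<Sum>v\<in>V. x v * (1 - x v)) \<le> p * q * N"
  shows "good_split V E s t"
proof -
  obtain y where y: "\<forall>v\<in>V. 0 \<le> y v \<and> y v \<le> 1"
    "(\<Sum>v\<in>V. (deg v - dens) * y v) = (\<Sum>v\<in>V. (deg v - dens) * x v)"
    "surplus V E (1 / 2) (p * dens) x \<le> surplus V E (1 / 2) (p * dens) y"
    "\<forall>u\<in>fractional V y. \<forall>v\<in>fractional V y. u \<noteq> v \<longrightarrow> {u, v} \<in> E \<and> (1 / 2 :: real) < 1 / 2"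
    using round_pairs[of x "1 / 2" "\<lambda>v. deg v - dens" "p * dens"] x by auto
  have y01: "0 \<le> y v \<and> y v \<le> 1" if "v \<in> V" for v using y(1) that by blast
  obtain u where u: "u \<in> V" "fractional V y \<subseteq> {u}"
  proof (cases "fractional V y = {}")
    case True
    then show ?thesis using that nonempty by auto
  next
    case False
    then obtain u where "u \<in> fractional V y" by auto
    moreover from this have "fractional V y \<subseteq> {u}" using y(4) by auto
    ultimately show ?thesis using that by (auto simp: fractional_def)
  qed
  define th where "th = y u"
  define A where "A = {v \<in> V - {u}. y v = 1}"
  define y' where "y' = (\<lambda>v. 1 - y v)"
  define B where "B = {v \<in> V - {u}. y' v = 1}"
  have th: "0 \<le> th" "th \<le> 1" using y01[OF u(1)] by (simp_all add: th_def)
  note Y = almost_integral[OF y(1) u(2,1), folded A_def, folded th_def]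
  have y'01: "\<forall>v\<in>V. 0 \<le> y' v \<and> y' v \<le> 1" using y01 by (simp add: y'_def)
  have "fractional V y' \<subseteq> {u}" using u(2) by (auto simp: fractional_def y'_def)
  note Y' = almost_integral[OF y'01 this u(1), folded B_def]
  have y'u: "y' u = 1 - th" by (simp add: y'_def th_def)
  have AB: "A \<subseteq> V - {u}" "B \<subseteq> V - {u}" "A \<inter> B = {}" by (auto simp: A_def B_def y'_def)
  have cover: "V = insert u (A \<union> B)"
  proof (intro equalityI subsetI)
    fix v assume v: "v \<in> V"
    show "v \<in> insert u (A \<union> B)"
    proof (cases "v = u \<or> v \<in> A")
      case False
      then have "y v = 0" using Y(1)[OF v] by simp
      then show ?thesis using v False by (simp add: B_def y'_def)
    qed auto
  qed (use u(1) AB in auto)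
  have WA: "edge_weight E ((\<lambda>v. of_bool (v \<in> A))(u := th)) = edge_weight E y"
    by (rule edge_weight_cong) (simp add: Y(1))
  have WB: "edge_weight E ((\<lambda>v. of_bool (v \<in> B))(u := 1 - th)) = edge_weight E y'"
    using Y'(1) unfolding y'u by (intro edge_weight_cong) simp
  have sy': "sum y' V = n - sum y V" by (simp add: y'_def sum_subtractf)
  have F: "- (p * q * N / 2) + th * (1 - th) / 2 \<le> edge_weight E y - p * dens * sum y V"
    using y(3) surplus var unfolding surplus_def Y(3) by linarith
  have degy: "(\<Sum>v\<in>V. deg v * y v) = p * dens * n + dens * sum y V"
    using y(2) balance by (simp add: weight_sum)
  have q: "q = 1 - p" using shares by simp
  have "edge_weight E y' - q * dens * sum y' V = edge_weight E y - p * dens * sum y V"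
    unfolding sy' unfolding y'_def edge_weight_complement degy edges_eq q by (simp add: algebra_simps)
  then have G: "- (p * q * N / 2) + th * (1 - th) / 2 \<le> edge_weight E y' - q * dens * sum y' V"
    using F by simp
  have balance': "(\<Sum>v\<in>V. (deg v - dens) * y' v) = q * dens * n"
  proof -
    have "(\<Sum>v\<in>V. (deg v - dens) * y' v) = sum deg V - dens * n - (\<Sum>v\<in>V. (deg v - dens) * y v)"
      by (simp add: y'_def algebra_simps sum_subtractf sum.distrib)
    then show ?thesis unfolding y(2) balance sum_deg q by (simp add: algebra_simps)
  qed
  have wu: "0 < deg u - dens" "deg u - dens \<le> n"
    using deg_gt_dens[OF u(1)] deg_le[OF u(1)] d_nonneg s t by auto
  have conc: "(\<Sum>v\<in>V. (deg v - dens) * z v) = (deg u - dens) * z u"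
    if "\<And>v. v \<in> V \<Longrightarrow> z v = ((\<lambda>v. of_bool (v \<in> C))(u := z u)) v" "C = {}" for z C
  proof -
    have "(\<Sum>v\<in>V. (deg v - dens) * z v) = (\<Sum>v\<in>{u}. (deg v - dens) * z v)"
      using that u(1) finite_vertices by (intro sum.mono_neutral_right) auto
    then show ?thesis by simp
  qed
  have nontrivA: "q < real (card A) + th"
  proof (rule ccontr)
    assume *: "\<not> q < real (card A) + th"
    then have "card A = 0" using th shares by simp
    moreover have "finite A" using finite_vertices by (simp add: A_def)
    ultimately have "A = {}" by simp
    then have "p * dens * n = (deg u - dens) * th"
      using conc[of y A] Y(1) balance y(2) by (simp add: th_def)
    also have "\<dots> \<le> n * q" using wu th * \<open>A = {}\<close> by (intro mult_mono) auto
    finally have "p * dens \<le> q" using n_pos by simp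
    then show False using p_dens_gt s by simp
  qed
  have nontrivB: "p < real (card B) + (1 - th)"
  proof (rule ccontr)
    assume *: "\<not> p < real (card B) + (1 - th)"
    then have "card B = 0" using th shares by simp
    moreover have "finite B" using finite_vertices by (simp add: B_def)
    ultimately have "B = {}" by simp
    then have "q * dens * n = (deg u - dens) * (1 - th)"
      using conc[of y' B] Y'(1) balance' by (simp add: y'u)
    also have "\<dots> \<le> n * p" using wu th * \<open>B = {}\<close> by (intro mult_mono) auto
    finally have "q * dens \<le> p" using n_pos by simp
    then show False using q_dens_gt t by simp
  qed
  have "link_weight V E (\<lambda>v. of_bool (v \<in> A)) u + link_weight V E (\<lambda>v. of_bool (v \<in> B)) u = deg u"
    unfolding link_weight_def sum.distrib[symmetric]
    by (rule sum.cong[OF refl]) (use cover AB in auto)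
  moreover have "p * dens + q * dens = dens" unfolding q by (simp add: algebra_simps)
  ultimately have link: "p * dens \<le> link_weight V E (\<lambda>v. of_bool (v \<in> A)) u
      \<or> q * dens \<le> link_weight V E (\<lambda>v. of_bool (v \<in> B)) u"
    using wu by linarith
  show ?thesis
  proof (rule split_from_almost_integral[OF AB u(1) th _ _ nontrivA nontrivB link])
    show "- (p * q * N / 2) + th * (1 - th) / 2 \<le> edge_weight E ((\<lambda>v. of_bool (v \<in> A))(u := th)) - p * dens * (real (card A) + th)"
      using F unfolding WA Y(2) .
    show "- (p * q * N / 2) + th * (1 - th) / 2 \<le> edge_weight E ((\<lambda>v. of_bool (v \<in> B))(u := 1 - th)) - q * dens * (real (card B) + (1 - th))"
      using G unfolding WB Y'(2) y'u .
  qed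
qed

text \<open>
  Here y is the fractional indicator of B.  The part of the clique K that goes to A is kept at weight
  at least pN; a clique of that weight satisfies the hypothesis on A in
  \<open>split_from_almost_integral\<close> by the factorisation in \<open>size_dichotomy\<close>, so all other vertices of A
  can be dropped.  First the weight of K in A is brought down to pN, without loss for B, unless K becomes
  integral on the way; by |K| \<le> N this leaves weight at most qN for B, which bounds the cost of
  rounding.  Then K is rounded with its total weight fixed.
\<close>

lemma split_large_clique:
  assumes y: "\<And>v. v \<in> V \<Longrightarrow> 0 \<le> y v \<and> y v \<le> 1"
    and clique: "\<And>u v. u \<in> fractional V y \<Longrightarrow> v \<in> fractional V y \<Longrightarrow> u \<noteq> v \<Longrightarrow> {u, v} \<in> E"
    and surplus: "0 \<le> surplus V E 0 (q * dens) y" and pos: "0 < sum y V"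
    and large: "p * N \<le> (\<Sum>v\<in>fractional V y. 1 - y v)"
  shows "good_split V E s t"
proof -
  define K where "K = fractional V y"
  have KV: "K \<subseteq> V" by (auto simp: K_def fractional_def)
  have finK: "finite K" using KV finite_vertices finite_subset by auto
  have KN: "real (card K) \<le> N" using clique_card_le[OF KV] clique by (auto simp: K_def)
  have q: "q = 1 - p" using shares by simp
  define T where "T = real (card K) - p * N"
  have yK: "sum y K \<le> T" using large finK by (simp add: T_def K_def sum_subtractf)
  have c: "1 / 2 < q * dens" using q_dens_gt t shares by simp
  obtain z where z: "\<And>v. v \<in> V \<Longrightarrow> 0 \<le> z v \<and> z v \<le> 1" "\<And>v. v \<notin> K \<Longrightarrow> z v = y v"
    "sum z K \<le> T" "0 \<le> surplus V E 0 (q * dens) z" "0 < sum z V" "sum z K = T \<or> fractional V z = {}"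
    using adjust_to_target[OF y _ KV yK surplus pos c] by (auto simp: K_def)
  have zK: "fractional V z \<subseteq> K"
  proof
    fix v assume v: "v \<in> fractional V z"
    show "v \<in> K"
    proof (rule ccontr)
      assume "v \<notin> K"
      then show False using z(2)[of v] v by (simp add: K_def fractional_def)
    qed
  qed
  have var: "(\<Sum>v\<in>V. z v * (1 - z v)) \<le> p * q * N"
  proof (cases "fractional V z = {}")
    case True
    have "(\<Sum>v\<in>V. z v * (1 - z v)) = 0"
    proof (rule sum.neutral, rule ballI)
      fix v assume "v \<in> V"
      then have "z v = 0 \<or> z v = 1" using True z(1)[of v] not_fractional[of v V z] by auto
      then show "z v * (1 - z v) = 0" by auto
    qed
    moreover have "0 \<le> p * q * N" using shares d_nonneg s t by (intro mult_nonneg_nonneg) auto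
    ultimately show ?thesis by simp
  next
    case False
    then have zT: "sum z K = T" using z(6) by simp
    have comp: "fractional V (\<lambda>v. 1 - z v) = fractional V z" by (auto simp: fractional_def)
    have "(\<Sum>v\<in>V. (1 - z v) * (1 - (1 - z v))) \<le> p * q * N"
    proof (rule variance_sum_le[of "\<lambda>v. 1 - z v" K])
      show "(\<Sum>v\<in>K. 1 - z v) \<le> p * N" using finK zT by (simp add: sum_subtractf T_def)
      show "(\<Sum>v\<in>K. 1 - (1 - z v)) \<le> q * N"
        using zT KN unfolding T_def q by (simp add: algebra_simps)
    qed (use z(1) KV zK comp in auto)
    then show ?thesis by (simp add: mult.commute)
  qed
  obtain y' where y': "\<forall>v\<in>V. 0 \<le> y' v \<and> y' v \<le> 1"
    "\<forall>v. v \<notin> fractional V z \<longrightarrow> y' v = z v"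
    "(\<Sum>v\<in>V. 1 * y' v) = (\<Sum>v\<in>V. 1 * z v)"
    "surplus V E (1 / 2) (q * dens) z \<le> surplus V E (1 / 2) (q * dens) y'"
    "\<forall>u\<in>fractional V y'. \<forall>v\<in>fractional V y'. u \<noteq> v \<longrightarrow> {u, v} \<in> E \<and> (1 / 2 :: real) < 1 / 2"
    using round_pairs[of z "1 / 2" "\<lambda>v. 1" "q * dens"] z(1) by auto
  have y'01: "0 \<le> y' v \<and> y' v \<le> 1" if "v \<in> V" for v using y'(1) that by blast
  have sumV: "sum y' V = sum z V" using y'(3) by simp
  have off: "y' v = z v" if "v \<notin> K" for v using y'(2) zK that by blast
  have y'K: "fractional V y' \<subseteq> K"
  proof
    fix v assume v: "v \<in> fractional V y'"
    show "v \<in> K"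
    proof (rule ccontr)
      assume "v \<notin> K"
      then show False using off[of v] zK v by (auto simp: fractional_def)
    qed
  qed
  have "0 < p * N" using shares d_nonneg s t by (intro mult_pos_pos) auto
  then have "fractional V y \<noteq> {}" using large by auto
  then obtain u where u: "u \<in> K" "fractional V y' \<subseteq> {u}"
  proof (cases "fractional V y' = {}")
    case True
    then show ?thesis using that \<open>fractional V y \<noteq> {}\<close> by (auto simp: K_def)
  next
    case False
    then obtain u where "u \<in> fractional V y'" by auto
    moreover from this have "fractional V y' \<subseteq> {u}" using y'(5) by auto
    ultimately show ?thesis using that y'K by auto
  qed
  have uV: "u \<in> V" using u KV by auto
  define th where "th = 1 - y' u"
  define B where "B = {v \<in> V - {u}. y' v = 1}"
  define A where "A = {v \<in> K - {u}. y' v = 0}"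
  have th: "0 \<le> th" "th \<le> 1" using y'01[OF uV] by (simp_all add: th_def)
  have y'u: "y' u = 1 - th" by (simp add: th_def)
  note Y = almost_integral[OF y'(1) u(2) uV, folded B_def, unfolded y'u]
  have AB: "A \<subseteq> V - {u}" "B \<subseteq> V - {u}" "A \<inter> B = {}" using KV by (auto simp: A_def B_def)
  have "sum z V = sum z K + sum z (V - K)" "sum y' V = sum y' K + sum y' (V - K)"
    using sum.subset_diff[OF KV finite_vertices] by (auto simp: add.commute)
  moreover have "sum z (V - K) = sum y' (V - K)" using off by (intro sum.cong) auto
  ultimately have "sum y' K \<le> T" using z(3) sumV by simp
  moreover have "(\<Sum>v\<in>K. 1 - y' v) = real (card A) + th"
  proof -
    have "(\<Sum>v\<in>K - {u}. 1 - y' v) = (\<Sum>v\<in>K - {u}. of_bool (v \<in> A))"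
    proof (rule sum.cong[OF refl])
      fix v assume v: "v \<in> K - {u}"
      then have "y' v = of_bool (v \<in> B)" using Y(1)[of v] KV by auto
      then show "1 - y' v = of_bool (v \<in> A)" using v by (auto simp: A_def)
    qed
    also have "\<dots> = real (card ((K - {u}) \<inter> A))"
      using finK by (simp add: of_bool_def sum.If_cases)
    also have "(K - {u}) \<inter> A = A" by (auto simp: A_def)
    finally show ?thesis
      using sum.remove[OF finK u(1), of "\<lambda>v. 1 - y' v"] by (simp add: th_def)
  qed
  ultimately have sizeA: "p * N \<le> real (card A) + th"
    using finK by (simp add: sum_subtractf T_def)
  have uA: "u \<notin> A" by (simp add: A_def)
  have cl: "{v, w} \<in> E" if "v \<in> insert u A" "w \<in> insert u A" "v \<noteq> w" for v w
    using clique that u(1) by (auto simp: K_def A_def)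
  have sub: "insert u A \<subseteq> V" using AB uV by auto
  have nontrivA: "q < real (card A) + th"
    using sizeA p_dens_gt s shares unfolding pN by linarith
  have nontrivB: "p < real (card B) + (1 - th)"
  proof -
    have "2 * (q * dens) \<le> sum z V"
      using sum_ge_if_surplus_nonneg[OF _ z(4,5)] z(1) by blast
    then show ?thesis using q_dens_gt t shares sumV Y(2) by linarith
  qed
  have F: "- (p * q * N / 2) + th * (1 - th) / 2
      \<le> edge_weight E ((\<lambda>v. of_bool (v \<in> A))(u := th)) - p * dens * (real (card A) + th)"
  proof -
    let ?z = "real (card A) + th"
    have "2 * edge_weight E ((\<lambda>v. of_bool (v \<in> A))(u := th)) = ?z\<^sup>2 - (real (card A) + th\<^sup>2)"
      using edge_weight_clique[OF sub cl, of "(\<lambda>v. of_bool (v \<in> A))(u := th)"]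
      unfolding indicator_sums[OF AB(1) uV] by simp
    moreover have "0 \<le> (?z - q) * (?z - p * N)"
      using sizeA nontrivA by (intro mult_nonneg_nonneg) auto
    then have "0 \<le> ?z\<^sup>2 - ?z - 2 * (p * dens * ?z) + p * q * N"
      unfolding q by (simp add: algebra_simps power2_eq_square)
    ultimately show ?thesis by (simp add: field_simps power2_eq_square)
  qed
  have G: "- (p * q * N / 2) + th * (1 - th) / 2
      \<le> edge_weight E ((\<lambda>v. of_bool (v \<in> B))(u := 1 - th)) - q * dens * (real (card B) + (1 - th))"
  proof -
    have "edge_weight E ((\<lambda>v. of_bool (v \<in> B))(u := 1 - th)) = edge_weight E y'"
      using Y(1) by (intro edge_weight_cong) simp
    moreover have "- (p * q * N / 2) + (1 - th) * (1 - (1 - th)) / 2 \<le> edge_weight E y' - q * dens * sum y' V"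
      using y'(4) z(4) var Y(3) unfolding surplus_def by linarith
    ultimately show ?thesis using Y(2) by (simp add: mult.commute)
  qed
  have "link_weight V E (\<lambda>v. of_bool (v \<in> A)) u = real (card A)"
    using link_weight_clique[OF sub cl, of "\<lambda>v. of_bool (v \<in> A)" u] uA
    by (simp add: indicator_sums[OF AB(1) uV])
  then have "p * dens \<le> link_weight V E (\<lambda>v. of_bool (v \<in> A)) u"
    using sizeA th p_dens_gt s shares unfolding pN by linarith
  then show ?thesis
    using split_from_almost_integral[OF AB uV th F G nontrivA nontrivB] by simp
qed

lemma exists_good_split: "good_split V E s t"
proof -
  have q: "q = 1 - p" using shares by simp
  have "edge_weight E (\<lambda>_. p) = p\<^sup>2 * real (card E)"
    using edge_card by (simp add: edge_weight_def)
  then have start: "surplus V E 0 (p * dens) (\<lambda>_. p) = 0"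
    by (simp add: surplus_def edges_eq power2_eq_square)
  obtain x where x: "\<forall>v\<in>V. 0 \<le> x v \<and> x v \<le> 1"
    "(\<Sum>v\<in>V. (deg v - dens) * x v) = (\<Sum>v\<in>V. (deg v - dens) * p)"
    "0 \<le> surplus V E 0 (p * dens) x"
    "\<forall>u\<in>fractional V x. \<forall>v\<in>fractional V x. u \<noteq> v \<longrightarrow> {u, v} \<in> E"
    using round_pairs[of "\<lambda>_. p" 0 "\<lambda>v. deg v - dens" "p * dens"] shares unfolding start by auto
  have x01: "0 \<le> x v \<and> x v \<le> 1" if "v \<in> V" for v using x(1) that by blast
  have balance: "(\<Sum>v\<in>V. (deg v - dens) * x v) = p * dens * n"
    unfolding x(2) sum_distrib_right[symmetric] sum_subtractf sum_deg by (simp add: algebra_simps)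
  define y where "y = (\<lambda>v. 1 - x v)"
  have y01: "0 \<le> y v \<and> y v \<le> 1" if "v \<in> V" for v using x01[OF that] by (simp add: y_def)
  have fr: "fractional V y = fractional V x" by (auto simp: fractional_def y_def)
  have frV: "fractional V x \<subseteq> V" by (auto simp: fractional_def)
  have dens_pos: "0 < dens" using d_nonneg s t by simp
  have degx: "(\<Sum>v\<in>V. deg v * x v) = p * dens * n + dens * sum x V"
    using balance by (simp add: weight_sum)
  have sumy: "sum y V = n - sum x V" by (simp add: y_def sum_subtractf)
  have Wy: "edge_weight E y = edge_weight E x + dens * n - (p * dens * n + dens * sum x V)"
    unfolding y_def edge_weight_complement degx edges_eq by simp
  have "surplus V E 0 (q * dens) y = surplus V E 0 (p * dens) x"
    unfolding surplus_def Wy sumy q by (simp add: algebra_simps)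
  then have ysurplus: "0 \<le> surplus V E 0 (q * dens) y" using x(3) by simp
  have posx: "0 < sum x V"
  proof (rule ccontr)
    assume "\<not> 0 < sum x V"
    moreover have "0 \<le> sum x V" using x01 by (intro sum_nonneg) auto
    ultimately have "\<forall>v\<in>V. x v = 0"
      using sum_nonneg_eq_0_iff[OF finite_vertices, of x] x01 by auto
    then have "p * dens * n = 0" using balance by simp
    then show False using shares dens_pos n_pos by simp
  qed
  have posy: "0 < sum y V"
  proof (rule ccontr)
    assume "\<not> 0 < sum y V"
    moreover have "0 \<le> sum y V" using y01 by (intro sum_nonneg) auto
    ultimately have "\<forall>v\<in>V. y v = 0"
      using sum_nonneg_eq_0_iff[OF finite_vertices, of y] y01 by auto
    then have "p * dens * n = (\<Sum>v\<in>V. deg v - dens)" using balance by (simp add: y_def)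
    then have "q * dens * n = 0" unfolding sum_subtractf sum_deg q by (simp add: algebra_simps)
    then show False using shares dens_pos n_pos by simp
  qed
  \<comment> \<open>in the last case the roles of A and B, and with them those of s and t, are exchanged\<close>
  consider "sum x (fractional V x) \<le> p * N" "sum y (fractional V x) \<le> q * N"
    | "p * N \<le> sum x (fractional V x)" | "q * N \<le> sum y (fractional V x)" by linarith
  then show ?thesis
  proof cases
    case 1
    have "(\<Sum>v\<in>V. x v * (1 - x v)) \<le> p * q * N"
      using 1 variance_sum_le[OF x01 frV order_refl] by (simp add: y_def)
    then show ?thesis using split_small_clique[OF x01 balance x(3)] by simp
  next
    case 2
    show ?thesis
      by (rule split_large_clique[OF y01 _ ysurplus posy]) (use 2 x(4) in \<open>auto simp: fr\<close>, simp add: y_def)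
  next
    case 3
    have "good_split V E t s"
      by (rule dense_core.split_large_clique[OF swap x01 _ x(3) posx]) (use 3 x(4) in \<open>auto simp: y_def\<close>)
    then show ?thesis by (simp add: good_split_commute)
  qed
qed

end

section \<open>Pairs of dense subgraphs\<close>

theorem theorem4:
  fixes V :: "'a set" and E :: "'a set set" and s t :: real
  assumes "s > 1 / 2" and "t > 1 / 2"
    and "finite_simple_graph V E"
    and "V \<noteq> {}"
    and "real (num_edges E V) - (s + t + 1) * real (card V) \<ge> 0"
  shows "\<exists>A B. A \<subseteq> V \<and> B \<subseteq> V \<and> A \<inter> B = {} \<and> A \<noteq> {} \<and> B \<noteq> {}
    \<and> real (num_edges E A) - s * real (card A) \<ge> 0
    \<and> real (num_edges E B) - t * real (card B) \<ge> 0
    \<and> (real (num_edges E A) - s * real (card A)) + (real (num_edges E B) - t * real (card B))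
        \<ge> excess E s t (A \<union> B) - 1"
proof -
  interpret G: finite_simple_graph V E by fact
  define P where "P X \<longleftrightarrow> X \<subseteq> V \<and> X \<noteq> {} \<and> (s + t + 1) * real (card X) \<le> real (num_edges E X)" for X
  have "P V" using assms by (simp add: P_def)
  then obtain W where W: "P W" "\<And>X. P X \<Longrightarrow> card W \<le> card X"
    using ex_has_least_nat[of P V card] by blast
  have WV: "W \<subseteq> V" "W \<noteq> {}" using W(1) by (auto simp: P_def)
  have finW: "finite W" using WV(1) G.finite_vertices finite_subset by auto
  let ?F = "induced_edges E W"
  have eq: "num_edges ?F X = num_edges E X" if "X \<subseteq> W" for X
    using that unfolding num_edges_def induced_edges_def by (intro arg_cong[where f = card]) auto
  interpret C: dense_core W ?F s t
  proof
    show "finite W" by fact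
    show "e \<subseteq> W" if "e \<in> ?F" for e using that by (simp add: induced_edges_def)
    show "card e = 2" if "e \<in> ?F" for e using that G.edge_card by (simp add: induced_edges_def)
    show "W \<noteq> {}" by fact
    show "(s + t + 1) * real (card W) \<le> real (num_edges ?F W)"
      using W(1) eq[of W] by (simp add: P_def)
    show "real (num_edges ?F X) < (s + t + 1) * real (card X)" if X: "X \<subseteq> W" "X \<noteq> {}" "X \<noteq> W" for X
    proof (rule ccontr)
      assume "\<not> real (num_edges ?F X) < (s + t + 1) * real (card X)"
      then have "P X" using X WV eq[of X] by (auto simp: P_def)
      then have "card W \<le> card X" by (rule W(2))
      moreover have "card X < card W" using X finW by (intro psubset_card_mono) auto
      ultimately show False by simp
    qed
  qed (use assms in auto)
  obtain A B where AB: "A \<subseteq> W" "B \<subseteq> W" "A \<inter> B = {}" "A \<noteq> {}" "B \<noteq> {}"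
    "real (num_edges ?F A) - s * real (card A) \<ge> 0" "real (num_edges ?F B) - t * real (card B) \<ge> 0"
    "(real (num_edges ?F A) - s * real (card A)) + (real (num_edges ?F B) - t * real (card B))
      \<ge> excess ?F s t (A \<union> B) - 1"
    using C.exists_good_split unfolding good_split_def by blast
  have "excess ?F s t (A \<union> B) = excess E s t (A \<union> B)"
    using eq[of "A \<union> B"] AB(1,2) by (simp add: excess_def)
  then show ?thesis
    using AB WV(1) eq[OF AB(1)] eq[OF AB(2)] by (intro exI[of _ A] exI[of _ B]) auto
qed

end
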